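(* Let $0<\beta<1$ and $T>0$. For any $h\in\mathcal{H}_{1/2}$ and $F,G\in\mathcal{F}C_b^\infty$, $$\mathbb{E}\big[G\,\partial_{1,h}F\big]=\mathbb{E}\big[F\,\partial_{1,h}^*G\big],$$ where $$\partial_{1,h}^*G=-\partial_{1,h}G+G\left(\int_0^\cdot\dot h(t)\,\mathrm{d}W^{1/2}(t)\right)(T\mathcal{Y}_\beta)$$ and $\mathbb{E}$ is the expectation with respect to $\mathbb{P}_{1/2}\otimes\mathbb{P}_{Y_\beta}$.
   Context: $\mathbb{R}^+=[0,\infty)$. $\mathbb{W}$ is the space of continuous $w:\mathbb{R}^+\to\mathbb{R}$ with $w(0)=0$, with the topology of locally uniform convergence; $\mathbb{P}_{1/2}$ is Wiener measure on $\mathbb{W}$, and $W^{1/2}(t)(w)=w(t)$ is the canonical Brownian motion. $\mathbb{P}_{Y_\beta}$ is the probability measure on $\mathbb{R}^+$ with density $M_\beta$ determined by $\int_0^\infty e^{-s\tau}M_\beta(\tau)\,d\tau=E_\beta(-s)$, $s\ge0$, with $E_\beta(z)=\sum_{n\ge0}z^n/\Gamma(\beta n+1)$. $\mathcal{Y}_\beta(\tau)=\tau$ on $\mathbb{R}^+$. $\mathcal{H}_{1/2}$ is the space of functions $h(t)=\int_0^t\dot h(s)\,\mathrm{d}s$ with $\dot h\in L^2(\mathbb{R}^+)$ (Lebesgue measure). $\mathcal{F}C_b^\infty$ (depending on $T$) is the class of functions $F:\mathbb{W}\times\mathbb{R}^+\to\mathbb{R}$ of the form $F(w,\tau)=f(w(t_1\tau),\dots,w(t_n\tau))$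 with $n\in\mathbb{N}$, $0<t_1<\dots<t_n\le T$ and $f\in C_b^\infty(\mathbb{R}^n)$, the set of $C^\infty$ real-valued functions bounded together with all their partial derivatives. For such $F$ and $h\in\mathcal{H}_{1/2}$, $(\partial_{1,h}F)(w,\tau)=\lim_{\varepsilon\to0}\varepsilon^{-1}\big(F(w+\varepsilon h,\tau)-F(w,\tau)\big)=\sum_{i=1}^n\partial_if(w(t_1\tau),\dots,w(t_n\tau))\,h(t_i\tau)$. $\big(\int_0^\cdot\dot h\,\mathrm{d}W^{1/2}\big)(T\mathcal{Y}_\beta)$ is the random variable $(w,\tau)\mapsto\big(\int_0^{T\tau}\dot h(t)\,\mathrm{d}W^{1/2}(t)\big)(w)$ (continuous version of the Wiener integral process). *)

theory Defs
  imports "HOL-Probability.Probability"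
begin

section \<open>Path space and Wiener measure\<close>

text \<open>
  A continuous path on \<open>[0,\<infinity>)\<close> starting at 0 is represented by a function on the reals that is
  extended by 0 to the negative half-line, so that every such path has exactly one representative
  and the representatives form a vector space.
\<close>

definition paths :: "(real \<Rightarrow> real) set" where
  "paths = {w. continuous_on {0..} w \<and> w 0 = 0 \<and> (\<forall>t<0. w t = 0)}"

definition path_open :: "(real \<Rightarrow> real) set \<Rightarrow> bool" where
  "path_open U \<longleftrightarrow> U \<subseteq> paths \<and>
     (\<forall>w\<in>U. \<exists>N e. 0 < e \<and> {v \<in> paths. \<forall>t\<in>{0..N}. \<bar>v t - w t\<bar> < e} \<subseteq> U)"

lemma istopology_path_open: "istopology path_open"
  unfolding istopology_def
proof (intro conjI allI impI)
  fix S T assume S: "path_open S" and T: "path_open T"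
  show "path_open (S \<inter> T)"
    unfolding path_open_def
  proof (intro conjI ballI)
    show "S \<inter> T \<subseteq> paths" using S by (auto simp: path_open_def)
    fix w assume w: "w \<in> S \<inter> T"
    obtain N e where 1: "0 < e" "{v \<in> paths. \<forall>t\<in>{0..N}. \<bar>v t - w t\<bar> < e} \<subseteq> S"
      using S w unfolding path_open_def by blast
    obtain N' e' where 2: "0 < e'" "{v \<in> paths. \<forall>t\<in>{0..N'}. \<bar>v t - w t\<bar> < e'} \<subseteq> T"
      using T w unfolding path_open_def by blast
    have "{v \<in> paths. \<forall>t\<in>{0..max N N'}. \<bar>v t - w t\<bar> < min e e'} \<subseteq> S \<inter> T"
    proof
      fix v assume v: "v \<in> {v \<in> paths. \<forall>t\<in>{0..max N N'}. \<bar>v t - w t\<bar> < min e e'}"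
      have "v \<in> S" using v by (intro subsetD[OF 1(2)]) auto
      moreover have "v \<in> T" using v by (intro subsetD[OF 2(2)]) auto
      ultimately show "v \<in> S \<inter> T" by blast
    qed
    then show "\<exists>N e. 0 < e \<and> {v \<in> paths. \<forall>t\<in>{0..N}. \<bar>v t - w t\<bar> < e} \<subseteq> S \<inter> T"
      using 1(1) 2(1) by (intro exI[of _ "max N N'"] exI[of _ "min e e'"]) simp
  qed
next
  fix K assume K: "\<forall>U\<in>K. path_open U"
  show "path_open (\<Union>K)"
    unfolding path_open_def
  proof (intro conjI ballI)
    show "\<Union>K \<subseteq> paths" using K by (auto simp: path_open_def)
    fix w assume "w \<in> \<Union>K"
    then obtain U where U: "U \<in> K" "w \<in> U" by blast
    then obtain N e where "0 < e" "{v \<in> paths. \<forall>t\<in>{0..N}. \<bar>v t - w t\<bar> < e} \<subseteq> U"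
      using K unfolding path_open_def by blast
    then show "\<exists>N e. 0 < e \<and> {v \<in> paths. \<forall>t\<in>{0..N}. \<bar>v t - w t\<bar> < e} \<subseteq> \<Union>K"
      using U(1) by blast
  qed
qed

definition path_topology :: "(real \<Rightarrow> real) topology" where
  "path_topology = topology path_open"

lemma openin_path_topology: "openin path_topology = path_open"
  by (simp add: path_topology_def istopology_path_open)

lemma topspace_path_topology: "topspace path_topology = paths"
proof -
  have "path_open paths"
    unfolding path_open_def by (auto intro: exI[of _ "1::real"])
  then show ?thesis
    by (auto simp: topspace_def openin_path_topology path_open_def)
qed

text \<open>
  The first two lines say that \<open>P\<close> is a probability on the Borel sigma-algebra of the path space;
  the other two that the coordinate process is a standard Brownian motion.
\<close>

definition wiener_measure :: "(real \<Rightarrow> real) measure \<Rightarrow> bool" where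
  "wiener_measure P \<longleftrightarrow>
     prob_space P \<and> space P = paths \<and>
     sets P = sigma_sets paths {U. openin path_topology U} \<and>
     (\<forall>s t. 0 \<le> s \<longrightarrow> s < t \<longrightarrow>
        distributed P lborel (\<lambda>w. w t - w s) (\<lambda>x. ennreal (normal_density 0 (sqrt (t - s)) x))) \<and>
     (\<forall>(n::nat) t. 0 \<le> t 0 \<longrightarrow> (\<forall>i<n. t i \<le> t (Suc i)) \<longrightarrow>
        prob_space.indep_vars P (\<lambda>_. borel) (\<lambda>i w. w (t (Suc i)) - w (t i)) {..<n})"

section \<open>The law of the random time\<close>

abbreviation lebesgue_Rplus :: "real measure" where
  "lebesgue_Rplus \<equiv> restrict_space lborel {0..}"

definition mittag_leffler :: "real \<Rightarrow> real \<Rightarrow> real" where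
  "mittag_leffler \<beta> z = (\<Sum>n. z ^ n / Gamma (\<beta> * real n + 1))"

definition is_M_density :: "real \<Rightarrow> (real \<Rightarrow> real) \<Rightarrow> bool" where
  "is_M_density \<beta> M \<longleftrightarrow>
     M \<in> borel_measurable lebesgue_Rplus \<and> (\<forall>\<tau>\<ge>0. 0 \<le> M \<tau>) \<and>
     (\<forall>s\<ge>0. (\<integral>\<tau>. exp (- s * \<tau>) * M \<tau> \<partial>lebesgue_Rplus) = mittag_leffler \<beta> (- s))"

text \<open>The case \<open>s = 0\<close> above makes this a probability measure.\<close>

definition law_of_density :: "(real \<Rightarrow> real) \<Rightarrow> real measure" where
  "law_of_density M = density lebesgue_Rplus (\<lambda>\<tau>. ennreal (M \<tau>))"

section \<open>The Cameron-Martin space\<close>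

definition L2_Rplus :: "(real \<Rightarrow> real) set" where
  "L2_Rplus = {f. f \<in> borel_measurable lebesgue_Rplus \<and> integrable lebesgue_Rplus (\<lambda>s. (f s)\<^sup>2)}"

definition has_L2_derivative :: "(real \<Rightarrow> real) \<Rightarrow> (real \<Rightarrow> real) \<Rightarrow> bool" where
  "has_L2_derivative h h' \<longleftrightarrow> h' \<in> L2_Rplus \<and> (\<forall>t. h t = (LBINT s:{0..t}. h' s))"

text \<open>For \<open>t < 0\<close> the integral is over the empty set, matching the convention for \<open>paths\<close>.\<close>

definition cameron_martin :: "(real \<Rightarrow> real) set" where
  "cameron_martin = {h. \<exists>h'. has_L2_derivative h h'}"

section \<open>The Wiener integral\<close>

text \<open>
  A list of triples \<open>(a, s, u)\<close> stands for the step function that is the sum of the functions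
  \<open>a\<close> times the indicator of \<open>(s, u]\<close>.
\<close>

definition steps_valid :: "(real \<times> real \<times> real) list \<Rightarrow> bool" where
  "steps_valid xs \<longleftrightarrow> (\<forall>(a, s, u) \<in> set xs. 0 \<le> s \<and> s \<le> u)"

definition step_fun :: "(real \<times> real \<times> real) list \<Rightarrow> real \<Rightarrow> real" where
  "step_fun xs r = (\<Sum>(a, s, u)\<leftarrow>xs. a * indicator {s<..u} r)"

definition step_integral :: "(real \<times> real \<times> real) list \<Rightarrow> (real \<Rightarrow> real) \<Rightarrow> real" where
  "step_integral xs w = (\<Sum>(a, s, u)\<leftarrow>xs. a * (w u - w s))"

text \<open>
  \<open>X\<close> is a version of the Wiener integral of \<open>f\<close>: the limit in \<open>L\<^sup>2(P)\<close> of the integrals of step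
  functions that converge to \<open>f\<close> in \<open>L\<^sup>2\<close>.
\<close>

definition is_wiener_integral ::
    "(real \<Rightarrow> real) measure \<Rightarrow> (real \<Rightarrow> real) \<Rightarrow> ((real \<Rightarrow> real) \<Rightarrow> real) \<Rightarrow> bool" where
  "is_wiener_integral P f X \<longleftrightarrow>
     X \<in> borel_measurable P \<and>
     (\<exists>xs. (\<forall>k. steps_valid (xs k)) \<and>
        (\<lambda>k. \<integral>\<^sup>+r. ennreal ((step_fun (xs k) r - f r)\<^sup>2) \<partial>lebesgue_Rplus) \<longlonglongrightarrow> 0 \<and>
        (\<lambda>k. \<integral>\<^sup>+w. ennreal ((step_integral (xs k) w - X w)\<^sup>2) \<partial>P) \<longlonglongrightarrow> 0)"

definition is_continuous_wiener_integral_process ::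
    "(real \<Rightarrow> real) measure \<Rightarrow> (real \<Rightarrow> real) \<Rightarrow> (real \<Rightarrow> (real \<Rightarrow> real) \<Rightarrow> real) \<Rightarrow> bool" where
  "is_continuous_wiener_integral_process P f I \<longleftrightarrow>
     (\<forall>t\<ge>0. is_wiener_integral P (\<lambda>r. indicator {0..t} r * f r) (I t)) \<and>
     (\<forall>w\<in>paths. continuous_on {0..} (\<lambda>t. I t w))"

section \<open>Smooth cylinder functions\<close>

text \<open>
  \<open>\<real>\<^sup>n\<close> is the set of sequences vanishing from index \<open>n\<close> on; the product topology on sequences
  induces the Euclidean topology on it.
\<close>

definition Rn :: "nat \<Rightarrow> (nat \<Rightarrow> real) set" where
  "Rn n = {x. \<forall>i\<ge>n. x i = 0}"

definition partial_deriv :: "nat \<Rightarrow> ((nat \<Rightarrow> real) \<Rightarrow> real) \<Rightarrow> (nat \<Rightarrow> real) \<Rightarrow> real" where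
  "partial_deriv i f x = deriv (\<lambda>y. f (x(i := y))) (x i)"

primrec iter_partial :: "nat list \<Rightarrow> ((nat \<Rightarrow> real) \<Rightarrow> real) \<Rightarrow> (nat \<Rightarrow> real) \<Rightarrow> real" where
  "iter_partial [] f = f"
| "iter_partial (i # is) f = partial_deriv i (iter_partial is f)"

definition Cb_infinity :: "nat \<Rightarrow> ((nat \<Rightarrow> real) \<Rightarrow> real) set" where
  "Cb_infinity n = {f. \<forall>is. set is \<subseteq> {..<n} \<longrightarrow>
     continuous_on (Rn n) (iter_partial is f) \<and>
     bounded (iter_partial is f ` Rn n) \<and>
     (\<forall>x\<in>Rn n. \<forall>i<n. (\<lambda>y. iter_partial is f (x(i := y))) differentiable (at (x i)))}"

text \<open>The times \<open>t\<^sub>1 < \<dots> < t\<^sub>n\<close> are \<open>t 0, \<dots>, t (n - 1)\<close> here.\<close>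

definition FCb_infinity :: "real \<Rightarrow> ((real \<Rightarrow> real) \<times> real \<Rightarrow> real) set" where
  "FCb_infinity T = {F. \<exists>n t f.
     1 \<le> n \<and> (\<forall>i<n. 0 < t i \<and> t i \<le> T) \<and> strict_mono_on {..<n} t \<and> f \<in> Cb_infinity n \<and>
     (\<forall>w\<in>paths. \<forall>\<tau>\<ge>0. F (w, \<tau>) = f (\<lambda>i. if i < n then w (t i * \<tau>) else 0))}"

definition partial1 ::
    "(real \<Rightarrow> real) \<Rightarrow> ((real \<Rightarrow> real) \<times> real \<Rightarrow> real) \<Rightarrow> (real \<Rightarrow> real) \<times> real \<Rightarrow> real" where
  "partial1 h F = (\<lambda>(w, \<tau>). Lim (at 0) (\<lambda>\<epsilon>. (F (\<lambda>s. w s + \<epsilon> * h s, \<tau>) - F (w, \<tau>)) / \<epsilon>))"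

text \<open>\<open>I\<close> stands for the process of Wiener integrals of the derivative of \<open>h\<close>.\<close>

definition partial1_adjoint ::
    "real \<Rightarrow> (real \<Rightarrow> real) \<Rightarrow> (real \<Rightarrow> (real \<Rightarrow> real) \<Rightarrow> real) \<Rightarrow>
     ((real \<Rightarrow> real) \<times> real \<Rightarrow> real) \<Rightarrow> (real \<Rightarrow> real) \<times> real \<Rightarrow> real" where
  "partial1_adjoint T h I G =
     (\<lambda>(w, \<tau>). - partial1 h G (w, \<tau>) + G (w, \<tau>) * I (T * \<tau>) w)"

end

theory Submission
  imports Defs
begin

text \<open>
  For a fixed time \<open>\<tau>\<close> the product \<open>F G\<close> is a function \<open>\<Phi>\<close> of the path at finitely many times
  \<open>u \<le> T \<tau>\<close>, with gradient \<open>\<gamma>\<^sub>u\<close> in the coordinate \<open>w u\<close>, and the Leibniz rule turns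
  \<open>G \<partial>F + F \<partial>G\<close> into \<open>\<Sum>u. \<gamma>\<^sub>u h u\<close>. So the theorem says, for each \<open>\<tau>\<close>, that
  \<open>E[\<Phi> X] = \<Sum>u. E[\<gamma>\<^sub>u] h u\<close>, where \<open>X\<close> is the Wiener integral of \<open>h'\<close> over \<open>[0, T \<tau>]\<close>, and it then
  remains to integrate over \<open>\<tau>\<close>.

  Both sides are linear in \<open>h'\<close>, and both are continuous for the \<open>L\<^sup>2\<close> norm: the left side because
  \<open>\<Phi>\<close> is bounded and \<open>X\<close> is by definition an \<open>L\<^sup>2\<close> limit of integrals of step functions, the right
  side because \<open>h u\<close> is the integral of \<open>h'\<close> over \<open>[0, u]\<close>. Hence it is enough to treat the
  indicator of an interval \<open>(a, b]\<close>, whose integral is the increment \<open>w b - w a\<close>. By additivity the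
  interval can be cut at the times \<open>u\<close>, so that no \<open>u\<close> lies in its interior
  (\<open>wiener_integration_by_parts_gap\<close>). Then \<open>\<Phi>\<close> depends on this increment by a common shift of all
  coordinates \<open>w u\<close> with \<open>u \<ge> b\<close>, and on other increments, which are independent of it. Conditionally
  on those, the claim is the one-dimensional Gaussian integration by parts
  \<open>E[N \<psi>(N)] = \<sigma>\<^sup>2 E[\<psi>'(N)]\<close> (\<open>normal_density_integration_by_parts\<close>).

  Fubini's theorem needs integrability in \<open>(w, \<tau>)\<close>. The Wiener integrals are bounded in \<open>L\<^sup>2\<close>
  uniformly in time, by the isometry for step functions. The derivatives \<open>\<partial>F\<close> are sums of bounded
  functions times values \<open>h (t \<tau>)\<close>, which grow at most linearly in \<open>\<tau>\<close>. This growth is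
  integrable because \<open>\<tau>\<close> has a finite mean (\<open>M_density_first_moment\<close>), which follows from the
  behaviour at \<open>0\<close> of its Laplace transform, the Mittag-Leffler function.
\<close>


section \<open>Bounded smooth functions and the chain rule\<close>

lemma Cb_infinity_iter_partial:
  assumes "f \<in> Cb_infinity n" "set is \<subseteq> {..<n}"
  shows "iter_partial is f \<in> Cb_infinity n"
proof -
  have "iter_partial js (iter_partial is f) = iter_partial (js @ is) f" for js
    by (induction js) auto
  then show ?thesis
    using assms by (auto simp: Cb_infinity_def)
qed

lemma Cb_infinity_partial_deriv:
  "f \<in> Cb_infinity n \<Longrightarrow> i < n \<Longrightarrow> partial_deriv i f \<in> Cb_infinity n"
  using Cb_infinity_iter_partial[of f n "[i]"] by simp

lemma Cb_infinity_continuous: "f \<in> Cb_infinity n \<Longrightarrow> continuous_on (Rn n) f"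
  by (auto simp: Cb_infinity_def dest: spec[of _ "[]"])

lemma Cb_infinity_bounded: "f \<in> Cb_infinity n \<Longrightarrow> bounded (f ` Rn n)"
  by (auto simp: Cb_infinity_def dest: spec[of _ "[]"])

lemma Cb_infinity_has_partial_deriv:
  assumes "f \<in> Cb_infinity n" "x \<in> Rn n" "i < n"
  shows "((\<lambda>y. f (x(i := y))) has_real_derivative partial_deriv i f (x(i := y))) (at y)"
proof -
  have "x(i := y) \<in> Rn n"
    using assms by (auto simp: Rn_def)
  moreover have "\<forall>x\<in>Rn n. \<forall>i<n. (\<lambda>y. f (x(i := y))) differentiable (at (x i))"
    using assms(1) by (simp add: Cb_infinity_def) (drule spec[of _ "[]"], simp)
  ultimately have "(\<lambda>z. f (x(i := y, i := z))) differentiable (at ((x(i := y)) i))"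
    using assms(3) by blast
  then show ?thesis
    by (simp add: partial_deriv_def DERIV_deriv_iff_real_differentiable)
qed

text \<open>
  Induction on the number \<open>k\<close> of coordinates that move: the coordinate \<open>k\<close> is treated as a second
  real variable. Differentiability in two real variables needs continuity of only one of the two
  partial derivatives, here the one in coordinate \<open>k\<close>; the other is given by the induction hypothesis.
\<close>

lemma Cb_infinity_chain_rule_initial:
  assumes f: "f \<in> Cb_infinity n" and x: "x \<in> Rn n" and "k \<le> n"
  shows "((\<lambda>\<epsilon>. f (\<lambda>i. x i + (if i < k then \<epsilon> * v i else 0))) has_real_derivative
           (\<Sum>i<k. partial_deriv i f x * v i)) (at 0)"
  using \<open>k \<le> n\<close>
proof (induction k)
  case 0
  show ?case by simp
next
  case (Suc k)
  define p where "p s y = (\<lambda>i. x i + (if i < k then s * v i else if i = k then y else 0))" for s y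
  have p_Rn: "p s y \<in> Rn n" for s y
    using x Suc.prems by (auto simp: p_def Rn_def)
  have p_upd: "p s y = (p s 0)(k := x k + y)" for s y
    by (auto simp: p_def)
  define fy where "fy s y = (blinfun_scaleR_right (partial_deriv k f (p s y)) :: real \<Rightarrow>\<^sub>L real)" for s y
  have 1: "((\<lambda>s. f (p s 0)) has_derivative (\<lambda>h. (\<Sum>i<k. partial_deriv i f x * v i) * h))
      (at 0 within UNIV)"
    using Suc.IH Suc.prems
    by (simp add: has_field_derivative_def p_def cong: if_cong)
  have 2: "((\<lambda>y. f (p s y)) has_derivative blinfun_apply (fy s y)) (at y within UNIV)" for s y
  proof -
    have "((\<lambda>z. f ((p s 0)(k := z))) has_real_derivative partial_deriv k f ((p s 0)(k := x k + y)))
        (at (x k + y))"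
      by (intro Cb_infinity_has_partial_deriv[OF f p_Rn]) (use Suc.prems in auto)
    then have "((\<lambda>z. f ((p s 0)(k := x k + z))) has_real_derivative partial_deriv k f ((p s 0)(k := x k + y))) (at y)"
      using DERIV_shift[of "\<lambda>z. f ((p s 0)(k := z))" _ y "x k"] by (simp add: add.commute)
    then have "((\<lambda>y. f (p s y)) has_real_derivative partial_deriv k f (p s y)) (at y)"
      by (simp add: p_upd[of s, symmetric])
    moreover have "blinfun_apply (fy s y) = (*) (partial_deriv k f (p s y))"
      by (simp add: fy_def fun_eq_iff)
    ultimately show ?thesis
      by (simp add: has_field_derivative_def)
  qed
  have 3: "continuous (at (0, 0) within UNIV \<times> UNIV) (\<lambda>(s, y). fy s y)"
  proof -
    have "continuous_on UNIV (\<lambda>(s, y). p s y)"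
      unfolding p_def split_def
    proof (intro continuous_on_coordinatewise_then_product)
      show "continuous_on UNIV (\<lambda>z. x i + (if i < k then fst z * v i else if i = k then snd z else 0))" for i
        by (cases "i < k"; cases "i = k") (auto intro!: continuous_intros)
    qed
    then have "continuous_on UNIV (\<lambda>z. partial_deriv k f (case z of (s, y) \<Rightarrow> p s y))"
      by (intro continuous_on_compose2[OF Cb_infinity_continuous[OF Cb_infinity_partial_deriv[OF f]]])
         (use p_Rn Suc.prems in auto)
    then have "continuous_on UNIV (\<lambda>(s, y). fy s y)"
      unfolding fy_def split_def
      by (intro bounded_linear.continuous_on[OF bounded_linear_blinfun_scaleR_right])
    then show ?thesis
      by (simp add: continuous_on_eq_continuous_within)
  qed
  have "((\<lambda>(s, y). f (p s y)) has_derivative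
      (\<lambda>(ts, ty). (\<Sum>i<k. partial_deriv i f x * v i) * ts + fy 0 0 ty)) (at (0, 0) within UNIV \<times> UNIV)"
    by (rule has_derivative_partialsI[OF 1 2 3]) auto
  then have 4: "((\<lambda>(s, y). f (p s y)) has_derivative
      (\<lambda>(ts, ty). (\<Sum>i<k. partial_deriv i f x * v i) * ts + fy 0 0 ty)) (at (0, 0 * v k))"
    by simp
  have 5: "((\<lambda>\<epsilon>. (\<epsilon>, \<epsilon> * v k)) has_derivative (\<lambda>h. (h, h * v k))) (at 0)"
    by (auto intro!: derivative_eq_intros)
  have p00: "p 0 0 = x"
    by (auto simp: p_def)
  have "((\<lambda>\<epsilon>. f (p \<epsilon> (\<epsilon> * v k))) has_derivative
      (\<lambda>h. (\<Sum>i<k. partial_deriv i f x * v i) * h + fy 0 0 (h * v k))) (at 0)"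
    using has_derivative_compose[OF 5 4] by simp
  also have "(\<lambda>h. (\<Sum>i<k. partial_deriv i f x * v i) * h + fy 0 0 (h * v k)) =
      (*) (\<Sum>i<Suc k. partial_deriv i f x * v i)"
    by (auto simp: fy_def p00 algebra_simps)
  also have "(\<lambda>\<epsilon>. f (p \<epsilon> (\<epsilon> * v k))) = (\<lambda>\<epsilon>. f (\<lambda>i. x i + (if i < Suc k then \<epsilon> * v i else 0)))"
    by (intro ext arg_cong[where f=f]) (auto simp: p_def less_Suc_eq)
  finally show ?case
    by (simp add: has_field_derivative_def)
qed

lemma Cb_infinity_chain_rule:
  assumes f: "f \<in> Cb_infinity n"
  shows "((\<lambda>\<epsilon>. f (\<lambda>i. if i < n then x i + \<epsilon> * v i else 0)) has_real_derivative
           (\<Sum>i<n. partial_deriv i f (\<lambda>i. if i < n then x i else 0) * v i)) (at 0)"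
proof -
  have "(\<lambda>i. if i < n then x i else 0) \<in> Rn n"
    by (simp add: Rn_def)
  from Cb_infinity_chain_rule_initial[OF f this order_refl, of v]
  moreover have "(\<lambda>i. (if i < n then x i else 0) + (if i < n then \<epsilon> * v i else 0)) =
      (\<lambda>i. if i < n then x i + \<epsilon> * v i else 0)" for \<epsilon>
    by auto
  ultimately show ?thesis
    by simp
qed

section \<open>Differentiable cylinder functionals\<close>

text \<open>
  A bounded \<open>C\<^sup>1\<close> functional of the path at the times in \<open>U\<close>; \<open>\<gamma> u\<close> is its partial derivative with
  respect to the coordinate \<open>w u\<close>. The functional is defined on all functions, not only on paths,
  since the Gaussian integration by parts moves \<open>w\<close> along step functions, which are discontinuous.
  Unlike smooth functions of a fixed list of coordinates, these functionals can be multiplied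
  without renumbering the times.
\<close>

definition C1_cylinder ::
    "real set \<Rightarrow> ((real \<Rightarrow> real) \<Rightarrow> real) \<Rightarrow> (real \<Rightarrow> (real \<Rightarrow> real) \<Rightarrow> real) \<Rightarrow> bool" where
  "C1_cylinder U \<Phi> \<gamma> \<longleftrightarrow> finite U \<and> U \<subseteq> {0..} \<and>
     \<Phi> \<in> borel_measurable (PiM UNIV (\<lambda>_. borel)) \<and>
     (\<forall>u. \<gamma> u \<in> borel_measurable (PiM UNIV (\<lambda>_. borel))) \<and>
     bounded (range \<Phi>) \<and> (\<forall>u. bounded (range (\<gamma> u))) \<and>
     (\<forall>w k. ((\<lambda>\<epsilon>. \<Phi> (\<lambda>s. w s + \<epsilon> * k s)) has_real_derivative (\<Sum>u\<in>U. \<gamma> u w * k u)) (at 0)) \<and>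
     (\<forall>w k u. continuous_on UNIV (\<lambda>\<epsilon>. \<gamma> u (\<lambda>s. w s + \<epsilon> * k s))) \<and>
     (\<forall>w v. (\<forall>u\<in>U. w u = v u) \<longrightarrow> \<Phi> w = \<Phi> v \<and> (\<forall>u. \<gamma> u w = \<gamma> u v))"

lemma C1_cylinderD:
  assumes "C1_cylinder U \<Phi> \<gamma>"
  shows C1_cylinder_finite: "finite U" and C1_cylinder_nonneg: "U \<subseteq> {0..}"
    and C1_cylinder_measurable: "\<Phi> \<in> borel_measurable (PiM UNIV (\<lambda>_. borel))"
    and C1_cylinder_gradient_measurable: "\<gamma> u \<in> borel_measurable (PiM UNIV (\<lambda>_. borel))"
    and C1_cylinder_bounded: "bounded (range \<Phi>)"
    and C1_cylinder_gradient_bounded: "bounded (range (\<gamma> u))"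
    and C1_cylinder_deriv_0:
      "((\<lambda>\<epsilon>. \<Phi> (\<lambda>s. w s + \<epsilon> * k s)) has_real_derivative (\<Sum>u\<in>U. \<gamma> u w * k u)) (at 0)"
    and C1_cylinder_gradient_continuous: "continuous_on UNIV (\<lambda>\<epsilon>. \<gamma> u (\<lambda>s. w s + \<epsilon> * k s))"
  using assms by (simp_all add: C1_cylinder_def)

lemma C1_cylinder_cong:
  assumes "C1_cylinder U \<Phi> \<gamma>" and "\<And>u. u \<in> U \<Longrightarrow> w u = v u"
  shows "\<Phi> w = \<Phi> v" and "\<gamma> u w = \<gamma> u v"
  using assms unfolding C1_cylinder_def by meson+

lemma C1_cylinder_deriv:
  assumes "C1_cylinder U \<Phi> \<gamma>"
  shows "((\<lambda>\<epsilon>. \<Phi> (\<lambda>s. w s + \<epsilon> * k s)) has_real_derivative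
           (\<Sum>u\<in>U. \<gamma> u (\<lambda>s. w s + e * k s) * k u)) (at e)"
proof -
  have "((\<lambda>\<epsilon>. \<Phi> (\<lambda>s. w s + \<epsilon> * k s)) has_real_derivative
      (\<Sum>u\<in>U. \<gamma> u (\<lambda>s. w s + e * k s) * k u)) (at (0 + e))"
    using C1_cylinder_deriv_0[OF assms, of "\<lambda>s. w s + e * k s" k]
    by (subst DERIV_shift) (simp add: algebra_simps)
  then show ?thesis
    by simp
qed

lemma C1_cylinder_continuous:
  assumes "C1_cylinder U \<Phi> \<gamma>"
  shows "continuous_on UNIV (\<lambda>\<epsilon>. \<Phi> (\<lambda>s. w s + \<epsilon> * k s))"
  using C1_cylinder_deriv[OF assms] DERIV_isCont by (blast intro: continuous_at_imp_continuous_on)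

lemma C1_cylinder_mult:
  assumes 1: "C1_cylinder U \<Phi> \<gamma>" and 2: "C1_cylinder V \<Psi> \<delta>"
  shows "C1_cylinder (U \<union> V) (\<lambda>w. \<Phi> w * \<Psi> w)
     (\<lambda>u w. (if u \<in> U then \<gamma> u w * \<Psi> w else 0) + (if u \<in> V then \<Phi> w * \<delta> u w else 0))"
proof -
  note [measurable] = C1_cylinder_measurable[OF 1] C1_cylinder_measurable[OF 2]
    C1_cylinder_gradient_measurable[OF 1] C1_cylinder_gradient_measurable[OF 2]
  note fin = C1_cylinder_finite[OF 1] C1_cylinder_finite[OF 2]
  note deriv = C1_cylinder_deriv_0[OF 1] C1_cylinder_deriv_0[OF 2]
  have bdd_mult: "bounded (range (\<lambda>w. f w * g w))"
    if fg: "bounded (range f)" "bounded (range g)" for f g :: "(real \<Rightarrow> real) \<Rightarrow> real"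
  proof -
    obtain a b where "\<And>w. \<bar>f w\<bar> \<le> a" "\<And>w. \<bar>g w\<bar> \<le> b"
      using fg by (auto simp: bounded_iff)
    then have "\<bar>f w * g w\<bar> \<le> a * b" for w
      unfolding abs_mult by (intro mult_mono) (auto intro: order_trans[OF abs_ge_zero])
    then show ?thesis
      by (auto simp: bounded_iff)
  qed
  show ?thesis
    unfolding C1_cylinder_def
  proof (intro conjI allI impI)
    fix w k
    have "((\<lambda>\<epsilon>. \<Phi> (\<lambda>s. w s + \<epsilon> * k s) * \<Psi> (\<lambda>s. w s + \<epsilon> * k s)) has_real_derivative
       (\<Sum>u\<in>U. \<gamma> u w * k u) * \<Psi> w + (\<Sum>u\<in>V. \<delta> u w * k u) * \<Phi> w) (at 0)"
      using DERIV_mult[OF deriv(1)[of w k] deriv(2)[of w k]] by simp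
    also have "(\<Sum>u\<in>U. \<gamma> u w * k u) * \<Psi> w + (\<Sum>u\<in>V. \<delta> u w * k u) * \<Phi> w =
      (\<Sum>u\<in>U \<union> V. if u \<in> U then \<gamma> u w * \<Psi> w * k u else 0) +
      (\<Sum>u\<in>U \<union> V. if u \<in> V then \<Phi> w * \<delta> u w * k u else 0)"
      using fin by (simp add: sum.If_cases sum_distrib_left sum_distrib_right Int_absorb1 ac_simps)
    also have "\<dots> = (\<Sum>u\<in>U \<union> V. ((if u \<in> U then \<gamma> u w * \<Psi> w else 0) + (if u \<in> V then \<Phi> w * \<delta> u w else 0)) * k u)"
      unfolding sum.distrib[symmetric] by (intro sum.cong) (auto simp: algebra_simps)
    finally show "((\<lambda>\<epsilon>. \<Phi> (\<lambda>s. w s + \<epsilon> * k s) * \<Psi> (\<lambda>s. w s + \<epsilon> * k s)) has_real_derivative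
        (\<Sum>u\<in>U \<union> V. ((if u \<in> U then \<gamma> u w * \<Psi> w else 0) + (if u \<in> V then \<Phi> w * \<delta> u w else 0)) * k u)) (at 0)" .
    fix u
    show "continuous_on UNIV (\<lambda>\<epsilon>. (if u \<in> U then \<gamma> u (\<lambda>s. w s + \<epsilon> * k s) * \<Psi> (\<lambda>s. w s + \<epsilon> * k s) else 0) +
       (if u \<in> V then \<Phi> (\<lambda>s. w s + \<epsilon> * k s) * \<delta> u (\<lambda>s. w s + \<epsilon> * k s) else 0))"
      using C1_cylinder_continuous[OF 1] C1_cylinder_continuous[OF 2]
        C1_cylinder_gradient_continuous[OF 1] C1_cylinder_gradient_continuous[OF 2]
      by (cases "u \<in> U"; cases "u \<in> V") (auto intro!: continuous_intros)
    show "bounded (range (\<lambda>w. (if u \<in> U then \<gamma> u w * \<Psi> w else 0) + (if u \<in> V then \<Phi> w * \<delta> u w else 0)))"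
      using bdd_mult[OF C1_cylinder_gradient_bounded[OF 1] C1_cylinder_bounded[OF 2], of u]
        bdd_mult[OF C1_cylinder_bounded[OF 1] C1_cylinder_gradient_bounded[OF 2], of u]
      by (intro bounded_plus_comp) (cases "u \<in> U"; cases "u \<in> V"; simp)+
  next
    fix w v :: "real \<Rightarrow> real" assume "\<forall>u\<in>U \<union> V. w u = v u"
    then have "\<And>u. u \<in> U \<Longrightarrow> w u = v u" "\<And>u. u \<in> V \<Longrightarrow> w u = v u" by auto
    note c = C1_cylinder_cong[OF 1 this(1)] C1_cylinder_cong[OF 2 this(2)]
    show "\<Phi> w * \<Psi> w = \<Phi> v * \<Psi> v"
      "(if u \<in> U then \<gamma> u w * \<Psi> w else 0) + (if u \<in> V then \<Phi> w * \<delta> u w else 0) =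
       (if u \<in> U then \<gamma> u v * \<Psi> v else 0) + (if u \<in> V then \<Phi> v * \<delta> u v else 0)" for u
      by (simp_all only: c)
  next
    show "bounded (range (\<lambda>w. \<Phi> w * \<Psi> w))"
      by (rule bdd_mult[OF C1_cylinder_bounded[OF 1] C1_cylinder_bounded[OF 2]])
    show "U \<union> V \<subseteq> {0..}"
      using C1_cylinder_nonneg[OF 1] C1_cylinder_nonneg[OF 2] by simp
  qed (use fin in simp_all)
qed

lemma borel_measurable_Cb_infinity:
  assumes "f \<in> Cb_infinity n" and "\<And>i. i < n \<Longrightarrow> X i \<in> borel_measurable N"
  shows "(\<lambda>x. f (\<lambda>i. if i < n then X i x else 0)) \<in> borel_measurable N"
proof -
  have [measurable]: "(\<lambda>x i. if i < n then X i x else 0) \<in> borel_measurable N"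
  proof (intro measurable_coordinatewise_then_product)
    show "(\<lambda>x. if i < n then X i x else 0) \<in> borel_measurable N" for i
      using assms(2)[of i] by (cases "i < n") simp_all
  qed
  have "(\<lambda>x i. if i < n then X i x else 0) \<in> measurable N (restrict_space borel (Rn n))"
    by (intro measurable_restrict_space2) (auto simp: Rn_def)
  from measurable_compose[OF this borel_measurable_continuous_on_restrict[OF Cb_infinity_continuous[OF assms(1)]]]
  show ?thesis .
qed

text \<open>
  Several indices may share a time, for all times become \<open>0\<close> when they are scaled by the random time
  \<open>0\<close>; the gradient at a time therefore collects all indices that belong to it.
\<close>

lemma C1_cylinder_Cb_infinity:
  assumes f: "f \<in> Cb_infinity n" and t: "\<And>i. i < n \<Longrightarrow> 0 \<le> t i"
  shows "C1_cylinder (t ` {..<n}) (\<lambda>w. f (\<lambda>i. if i < n then w (t i) else 0))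
    (\<lambda>u w. \<Sum>i<n. if t i = u then partial_deriv i f (\<lambda>i. if i < n then w (t i) else 0) else 0)"
proof -
  have Rn: "(\<lambda>i. if i < n then x i else 0) \<in> Rn n" for x
    by (simp add: Rn_def)
  have bdd: "bounded (range (\<lambda>w. g (\<lambda>i. if i < n then w (t i) else 0)))" if "g \<in> Cb_infinity n" for g
    using Cb_infinity_bounded[OF that] by (rule bounded_subset) (auto simp: Rn)
  note pd = Cb_infinity_partial_deriv[OF f]
  show ?thesis
    unfolding C1_cylinder_def
  proof (intro conjI allI impI)
    show "(\<lambda>w. f (\<lambda>i. if i < n then w (t i) else 0)) \<in> borel_measurable (PiM UNIV (\<lambda>_. borel))"
      by (intro borel_measurable_Cb_infinity[OF f]) auto
    show "bounded (range (\<lambda>w. f (\<lambda>i. if i < n then w (t i) else 0)))"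
      by (rule bdd[OF f])
    fix u
    show "(\<lambda>w. \<Sum>i<n. if t i = u then partial_deriv i f (\<lambda>i. if i < n then w (t i) else 0) else 0)
       \<in> borel_measurable (PiM UNIV (\<lambda>_. borel))"
    proof (intro borel_measurable_sum)
      fix i assume "i \<in> {..<n}"
      then have [measurable]: "(\<lambda>w. partial_deriv i f (\<lambda>i. if i < n then w (t i) else 0))
           \<in> borel_measurable (PiM UNIV (\<lambda>_. borel))"
        by (intro borel_measurable_Cb_infinity[OF pd]) auto
      show "(\<lambda>w. if t i = u then partial_deriv i f (\<lambda>i. if i < n then w (t i) else 0) else 0)
           \<in> borel_measurable (PiM UNIV (\<lambda>_. borel))"
        by measurable
    qed
    have "bounded (range (\<lambda>w. \<Sum>i\<in>J. if t i = u then partial_deriv i f (\<lambda>i. if i < n then w (t i) else 0) else 0))"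
      if "J \<subseteq> {..<n}" for J
      using finite_subset[OF that finite_lessThan] that
    proof (induction rule: finite_induct)
      case (insert i J)
      then show ?case
        using bdd[OF pd, of i] by (cases "t i = u") (auto intro!: bounded_plus_comp)
    qed auto
    then show "bounded (range (\<lambda>w. \<Sum>i<n. if t i = u then partial_deriv i f (\<lambda>i. if i < n then w (t i) else 0) else 0))"
      by auto
    fix w k
    have "(\<Sum>i<n. partial_deriv i f (\<lambda>i. if i < n then w (t i) else 0) * k (t i)) =
      (\<Sum>i<n. \<Sum>u\<in>t ` {..<n}. if t i = u then partial_deriv i f (\<lambda>i. if i < n then w (t i) else 0) * k u else 0)"
      by (intro sum.cong) auto
    also have "\<dots> = (\<Sum>u\<in>t ` {..<n}. \<Sum>i<n. if t i = u then partial_deriv i f (\<lambda>i. if i < n then w (t i) else 0) * k u else 0)"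
      by (rule sum.swap)
    also have "\<dots> = (\<Sum>u\<in>t ` {..<n}. (\<Sum>i<n. if t i = u then partial_deriv i f (\<lambda>i. if i < n then w (t i) else 0) else 0) * k u)"
      by (simp add: sum_distrib_right if_distrib[of "\<lambda>z. z * _"] cong: if_cong)
    finally show "((\<lambda>\<epsilon>. f (\<lambda>i. if i < n then w (t i) + \<epsilon> * k (t i) else 0)) has_real_derivative
        (\<Sum>u\<in>t ` {..<n}. (\<Sum>i<n. if t i = u then partial_deriv i f (\<lambda>i. if i < n then w (t i) else 0) else 0) * k u)) (at 0)"
      using Cb_infinity_chain_rule[OF f, of "\<lambda>i. w (t i)" "\<lambda>i. k (t i)"] by simp
    have "continuous_on UNIV (\<lambda>\<epsilon> i. if i < n then w (t i) + \<epsilon> * k (t i) else 0)"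
    proof (intro continuous_on_coordinatewise_then_product)
      show "continuous_on UNIV (\<lambda>\<epsilon>. if i < n then w (t i) + \<epsilon> * k (t i) else 0)" for i
        by (cases "i < n") (auto intro!: continuous_intros)
    qed
    then have "continuous_on UNIV (\<lambda>\<epsilon>. partial_deriv i f (\<lambda>i. if i < n then w (t i) + \<epsilon> * k (t i) else 0))"
      if "i < n" for i
      by (intro continuous_on_compose2[OF Cb_infinity_continuous[OF pd[OF that]]])
         (auto simp: Rn_def)
    then show "continuous_on UNIV (\<lambda>\<epsilon>. \<Sum>i<n. if t i = u then partial_deriv i f (\<lambda>i. if i < n then w (t i) + \<epsilon> * k (t i) else 0) else 0)"
      by (intro continuous_on_sum, rename_tac i, case_tac "t i = u") auto
  next
    fix w v :: "real \<Rightarrow> real" assume "\<forall>u\<in>t ` {..<n}. w u = v u"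
    then have "(\<lambda>i. if i < n then w (t i) else 0) = (\<lambda>i. if i < n then v (t i) else 0)"
      by auto
    then show "f (\<lambda>i. if i < n then w (t i) else 0) = f (\<lambda>i. if i < n then v (t i) else 0)"
      "(\<Sum>i<n. if t i = u then partial_deriv i f (\<lambda>i. if i < n then w (t i) else 0) else 0) =
       (\<Sum>i<n. if t i = u then partial_deriv i f (\<lambda>i. if i < n then v (t i) else 0) else 0)" for u
      by (simp_all only:)
  qed (use t in auto)
qed

section \<open>Gaussian integration by parts\<close>

lemma normal_density_tendsto_0:
  assumes "0 < \<sigma>"
  shows "(normal_density 0 \<sigma> \<longlongrightarrow> 0) at_top" and "(normal_density 0 \<sigma> \<longlongrightarrow> 0) at_bot"
proof -
  have *: "(normal_density 0 \<sigma> \<longlongrightarrow> 0) F" if "filterlim (\<lambda>x::real. x\<^sup>2) at_top F" for F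
  proof -
    have "filterlim (\<lambda>x. 1 / (2 * \<sigma>\<^sup>2) * x\<^sup>2) at_top F"
      using assms by (intro filterlim_tendsto_pos_mult_at_top[OF tendsto_const _ that]) auto
    then have "filterlim (\<lambda>x. - (1 / (2 * \<sigma>\<^sup>2) * x\<^sup>2)) at_bot F"
      by (simp add: filterlim_uminus_at_bot)
    then have "((\<lambda>x. exp (- (1 / (2 * \<sigma>\<^sup>2) * x\<^sup>2))) \<longlongrightarrow> 0) F"
      by (rule filterlim_compose[OF exp_at_bot])
    then have "((\<lambda>x. 1 / sqrt (2 * pi * \<sigma>\<^sup>2) * exp (- (1 / (2 * \<sigma>\<^sup>2) * x\<^sup>2))) \<longlongrightarrow> 0) F"
      by (rule tendsto_mult_right_zero)
    then show ?thesis
      by (simp add: normal_density_def[abs_def])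
  qed
  show "(normal_density 0 \<sigma> \<longlongrightarrow> 0) at_top"
    by (intro * filterlim_pow_at_top filterlim_ident) simp
  show "(normal_density 0 \<sigma> \<longlongrightarrow> 0) at_bot"
    by (intro * filterlim_pow_at_bot_even filterlim_ident) simp_all
qed

lemma normal_density_has_derivative:
  assumes "0 < \<sigma>"
  shows "(normal_density 0 \<sigma> has_real_derivative - (x / \<sigma>\<^sup>2) * normal_density 0 \<sigma> x) (at x)"
  unfolding normal_density_def[abs_def] using assms
  by (auto intro!: derivative_eq_intros simp: field_simps power2_eq_square)

text \<open>
  Stein's identity: the density satisfies \<open>n' x = - (x / \<sigma>\<^sup>2) n x\<close>, so \<open>n \<psi>' - (x / \<sigma>\<^sup>2) n \<psi>\<close> is the
  derivative of \<open>n \<psi>\<close>, which vanishes at both infinities.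
\<close>

lemma normal_density_integration_by_parts:
  fixes \<psi> \<psi>' :: "real \<Rightarrow> real"
  assumes \<sigma>: "0 < \<sigma>" and deriv: "\<And>x. (\<psi> has_real_derivative \<psi>' x) (at x)"
    and cont: "continuous_on UNIV \<psi>'" and bdd: "bounded (range \<psi>)" "bounded (range \<psi>')"
  shows "(\<integral>x. normal_density 0 \<sigma> x * (\<psi> x * x) \<partial>lborel) =
         \<sigma>\<^sup>2 * (\<integral>x. normal_density 0 \<sigma> x * \<psi>' x \<partial>lborel)"
proof -
  let ?n = "normal_density 0 \<sigma>"
  obtain C D where C: "\<And>x. \<bar>\<psi> x\<bar> \<le> C" and D: "\<And>x. \<bar>\<psi>' x\<bar> \<le> D"
    using bdd by (auto simp: bounded_iff)
  have cont_\<psi>: "continuous_on UNIV \<psi>"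
    using deriv DERIV_isCont by (blast intro: continuous_at_imp_continuous_on)
  have cont_n: "continuous_on UNIV ?n"
    using normal_density_has_derivative[OF \<sigma>] DERIV_isCont by (blast intro: continuous_at_imp_continuous_on)
  have [measurable]: "\<psi> \<in> borel_measurable borel" "\<psi>' \<in> borel_measurable borel"
    using cont cont_\<psi> by (auto intro: borel_measurable_continuous_onI)
  have int1: "integrable lborel (\<lambda>x. ?n x * (\<psi> x * x))"
  proof (rule Bochner_Integration.integrable_bound)
    show "integrable lborel (\<lambda>x. C * (?n x * \<bar>x\<bar>))"
      using integrable_normal_moment_abs[OF \<sigma>, of 0 1] by simp
    have "\<bar>?n x * (\<psi> x * x)\<bar> \<le> C * (?n x * \<bar>x\<bar>)" for x
      using mult_right_mono[OF C[of x], of "?n x * \<bar>x\<bar>"] by (simp add: abs_mult ac_simps)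
    then show "AE x in lborel. norm (?n x * (\<psi> x * x)) \<le> norm (C * (?n x * \<bar>x\<bar>))"
      by (auto intro!: AE_I2 order_trans[OF _ abs_ge_self])
  qed simp
  have int2: "integrable lborel (\<lambda>x. ?n x * \<psi>' x)"
  proof (rule Bochner_Integration.integrable_bound)
    show "integrable lborel (\<lambda>x. D * ?n x)"
      using integrable_normal_density[OF \<sigma>, of 0] by simp
    have "\<bar>?n x * \<psi>' x\<bar> \<le> D * ?n x" for x
      using mult_right_mono[OF D[of x], of "?n x"] by (simp add: abs_mult ac_simps)
    then show "AE x in lborel. norm (?n x * \<psi>' x) \<le> norm (D * ?n x)"
      by (auto intro!: AE_I2 order_trans[OF _ abs_ge_self])
  qed simp
  let ?g = "\<lambda>x. ?n x * \<psi>' x - 1 / \<sigma>\<^sup>2 * (?n x * (\<psi> x * x))"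
  have lim: "((\<lambda>x. ?n x * \<psi> x) \<longlongrightarrow> 0) F" if "(?n \<longlongrightarrow> 0) F" for F
  proof (rule tendsto_0_le[where K=C, OF that])
    show "\<forall>\<^sub>F x in F. norm (?n x * \<psi> x) \<le> norm (?n x) * C"
      using C by (auto simp: abs_mult intro!: always_eventually mult_left_mono)
  qed
  have "(LBINT x=-\<infinity>..\<infinity>. ?g x) = 0 - 0"
  proof (rule interval_integral_FTC_integrable[where F="\<lambda>x. ?n x * \<psi> x"])
    show "((\<lambda>x. ?n x * \<psi> x) has_vector_derivative ?g x) (at x)" for x
      unfolding has_real_derivative_iff_has_vector_derivative[symmetric]
      by (rule DERIV_cong[OF DERIV_mult[OF normal_density_has_derivative[OF \<sigma>] deriv]])
         (simp add: field_simps)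
    show "isCont ?g x" for x
      using cont cont_n cont_\<psi> \<sigma>
      by (intro continuous_on_interior[of UNIV]) (auto intro!: continuous_intros)
    show "set_integrable lborel (einterval (-\<infinity>) \<infinity>) ?g"
      using int1 int2 by (simp add: set_integrable_def einterval_eq)
  qed (use lim[OF normal_density_tendsto_0(1)[OF \<sigma>]] lim[OF normal_density_tendsto_0(2)[OF \<sigma>]]
        in \<open>simp_all add: ereal_tendsto_simps\<close>)
  then have "(\<integral>x. ?g x \<partial>lborel) = 0"
    by (simp add: interval_lebesgue_integral_def set_lebesgue_integral_def einterval_eq)
  then have "(\<integral>x. ?n x * \<psi>' x \<partial>lborel) = 1 / \<sigma>\<^sup>2 * (\<integral>x. ?n x * (\<psi> x * x) \<partial>lborel)"
    using int1 int2 by simp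
  then show ?thesis
    using \<sigma> by (simp add: field_simps)
qed

section \<open>Integration by parts against Brownian increments\<close>

context
  fixes P
  assumes P: "wiener_measure P"
begin

lemma wiener_prob_space: "prob_space P" and wiener_space: "space P = paths"
  using P by (simp_all add: wiener_measure_def)

lemma wiener_increment:
  "0 \<le> s \<Longrightarrow> s < t \<Longrightarrow>
    distributed P lborel (\<lambda>w. w t - w s) (\<lambda>x. ennreal (normal_density 0 (sqrt (t - s)) x))"
  using P by (simp add: wiener_measure_def)

lemma wiener_measurable_coord: "(\<lambda>w. w t) \<in> borel_measurable P"
proof (cases "0 < t")
  case True
  have "(\<lambda>w. w t - w 0) \<in> borel_measurable P"
    using distributed_measurable[OF wiener_increment[OF order_refl True]] by simp
  then show ?thesis
    by (rule measurable_cong[THEN iffD1, rotated]) (simp add: wiener_space paths_def)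
next
  case False
  have "(\<lambda>w. 0) \<in> borel_measurable P"
    by simp
  then show ?thesis
    by (rule measurable_cong[THEN iffD1, rotated])
       (use False in \<open>auto simp: wiener_space paths_def not_less less_eq_real_def\<close>)
qed

lemma wiener_measurable_path: "(\<lambda>w. w) \<in> measurable P (PiM UNIV (\<lambda>_. borel))"
  using measurable_PiM_single'[of UNIV "\<lambda>t w. w t" P "\<lambda>_. borel"] wiener_measurable_coord
  by (simp add: eta_contract_eq)

lemma wiener_increment_square:
  assumes "0 \<le> s" "s \<le> t"
  shows "integrable P (\<lambda>w. (w t - w s)\<^sup>2)" and "(\<integral>w. (w t - w s)\<^sup>2 \<partial>P) = t - s"
proof -
  have "integrable P (\<lambda>w. (w t - w s)\<^sup>2) \<and> (\<integral>w. (w t - w s)\<^sup>2 \<partial>P) = t - s"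
  proof (cases "s = t")
    case False
    then have st: "s < t" "0 < sqrt (t - s)" using assms by auto
    note D = wiener_increment[OF assms(1) st(1)]
    show ?thesis
      using distributed_integrable[OF D, of "\<lambda>x. x\<^sup>2"] distributed_integral[OF D, of "\<lambda>x. x\<^sup>2"]
        integrable_normal_moment[OF st(2), of 0 2] integral_normal_moment_even[OF st(2), of 0 1] st
      by simp
  qed simp
  then show "integrable P (\<lambda>w. (w t - w s)\<^sup>2)" and "(\<integral>w. (w t - w s)\<^sup>2 \<partial>P) = t - s"
    by auto
qed

lemma wiener_increment_mean:
  assumes "0 \<le> s" "s \<le> t"
  shows "integrable P (\<lambda>w. w t - w s)" and "(\<integral>w. w t - w s \<partial>P) = 0"
proof -
  have "integrable P (\<lambda>w. w t - w s) \<and> (\<integral>w. w t - w s \<partial>P) = 0"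
  proof (cases "s = t")
    case False
    then have st: "s < t" "0 < sqrt (t - s)" using assms by auto
    note D = wiener_increment[OF assms(1) st(1)]
    show ?thesis
      using distributed_integrable[OF D, of "\<lambda>x. x"] distributed_integral[OF D, of "\<lambda>x. x"]
        integrable_normal_moment_nz_1[OF st(2), of 0] integral_normal_moment_nz_1[OF st(2), of 0] st
      by simp
  qed simp
  then show "integrable P (\<lambda>w. w t - w s)" and "(\<integral>w. w t - w s \<partial>P) = 0"
    by auto
qed

lemma C1_cylinder_wiener:
  assumes "C1_cylinder U \<Phi> \<gamma>"
  shows "\<Phi> \<in> borel_measurable P" and "\<gamma> u \<in> borel_measurable P"
    and "integrable P \<Phi>" and "integrable P (\<gamma> u)"
proof -
  interpret prob_space P by (rule wiener_prob_space)
  show [measurable]: "\<Phi> \<in> borel_measurable P" "\<gamma> u \<in> borel_measurable P"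
    using measurable_compose[OF wiener_measurable_path C1_cylinder_measurable[OF assms]]
      measurable_compose[OF wiener_measurable_path C1_cylinder_gradient_measurable[OF assms]] by auto
  obtain C D where "\<And>w. \<bar>\<Phi> w\<bar> \<le> C" "\<And>w. \<bar>\<gamma> u w\<bar> \<le> D"
    using C1_cylinder_bounded[OF assms] C1_cylinder_gradient_bounded[OF assms, of u]
    by (auto simp: bounded_iff)
  then show "integrable P \<Phi>" "integrable P (\<gamma> u)"
    using integrable_const_bound[of \<Phi> C] integrable_const_bound[of "\<gamma> u" D] by auto
qed

lemma integrable_C1_cylinder_mult:
  assumes "C1_cylinder U \<Phi> \<gamma>" and X: "integrable P X"
  shows "integrable P (\<lambda>w. \<Phi> w * X w)"
proof -
  obtain C where C: "\<And>w. \<bar>\<Phi> w\<bar> \<le> C"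
    using C1_cylinder_bounded[OF assms(1)] by (auto simp: bounded_iff)
  show ?thesis
  proof (rule Bochner_Integration.integrable_bound)
    show "integrable P (\<lambda>w. C * X w)" using X by simp
    show "(\<lambda>w. \<Phi> w * X w) \<in> borel_measurable P"
      using C1_cylinder_wiener(1)[OF assms(1)] X by simp
    show "AE w in P. norm (\<Phi> w * X w) \<le> norm (C * X w)"
      using order_trans[OF C abs_ge_self] by (auto simp: abs_mult intro!: AE_I2 mult_right_mono)
  qed
qed

text \<open>
  All relevant times are sorted into \<open>0 = t 0 < t 1 < \<dots>\<close>, where \<open>a\<close> and \<open>b\<close> are neighbours because of
  the gap. The path at the times of \<open>U\<close> is then the sum of a function of the increments outside
  \<open>(a, b]\<close> and of the increment over \<open>(a, b]\<close> times the step \<open>K = 1\<^bsub>[b, \<infinity>)\<^esub>\<close>. The two parts are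
  independent, so Stein's identity applies in the second one with the first one fixed.
\<close>

lemma wiener_integration_by_parts_gap:
  assumes cyl: "C1_cylinder U \<Phi> \<gamma>" and ab: "0 \<le> a" "a < b" and gap: "U \<inter> {a<..<b} = {}"
  shows "(\<integral>w. \<Phi> w * (w b - w a) \<partial>P) = (\<Sum>u\<in>U. (\<integral>w. \<gamma> u w \<partial>P) * (if b \<le> u then b - a else 0))"
proof -
  interpret prob_space P by (rule wiener_prob_space)
  define S where "S = U \<union> {0, a, b}"
  have fin_S: "finite S"
    using C1_cylinder_finite[OF cyl] by (simp add: S_def)
  have S_nonneg: "S \<subseteq> {0..}"
    using C1_cylinder_nonneg[OF cyl] ab by (auto simp: S_def)
  define xs where "xs = sorted_list_of_set S"
  have set_xs: "set xs = S"
    using fin_S by (simp add: xs_def)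
  define t where "t i = xs ! i" for i
  define m where "m = length xs"
  have t_S: "i < m \<Longrightarrow> t i \<in> S" for i
    using set_xs by (auto simp: t_def m_def)
  have S_t: "\<exists>i<m. s = t i" if "s \<in> S" for s
    using that set_xs by (metis in_set_conv_nth m_def t_def)
  have t_less: "t i < t j" if "i < j" "j < m" for i j
    using sorted_wrt_nth_less[of "(<)" xs i j] that by (simp add: xs_def t_def m_def)
  have t_less_iff: "t i < t j \<longleftrightarrow> i < j" if "i < m" "j < m" for i j
    using t_less[of i j] t_less[of j i] that by (metis less_asym nat_neq_iff order_less_irrefl)
  have t_le_iff: "t i \<le> t j \<longleftrightarrow> i \<le> j" if "i < m" "j < m" for i j
    using t_less_iff[OF that(2,1)] by (simp add: not_less[symmetric])
  obtain k where k: "k < m" "a = t k"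
    using S_t[of a] by (auto simp: S_def)
  obtain l where l: "l < m" "b = t l"
    using S_t[of b] by (auto simp: S_def)
  have "k < l"
    using ab(2) k l t_less_iff by simp
  have "l = Suc k"
  proof (rule ccontr)
    assume "l \<noteq> Suc k"
    then have "t k < t (Suc k)" "t (Suc k) < t l" "t (Suc k) \<in> S"
      using \<open>k < l\<close> l(1) t_less t_S by auto
    then show False
      using gap ab k l by (auto simp: S_def)
  qed
  have b: "Suc k < m" "b = t (Suc k)"
    using l \<open>l = Suc k\<close> by auto
  have t0: "t 0 = 0"
  proof -
    obtain i where "i < m" "0 = t i" using S_t[of 0] by (auto simp: S_def)
    moreover have "0 \<le> t 0" using t_S[of 0] S_nonneg \<open>i < m\<close> by auto
    ultimately show ?thesis using t_le_iff[of i 0] by (cases "i = 0") auto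
  qed
  define N where "N = m - 1"
  define J where "J = {..<N} - {k}"
  have k_N: "k < N" using b by (simp add: N_def)
  define X where "X i w = w (t (Suc i)) - w (t i)" for i and w :: "real \<Rightarrow> real"
  define Z where "Z w = restrict (\<lambda>i. X i w) J" for w
  have ind: "indep_vars (\<lambda>_. borel) X {..<N}"
  proof -
    have "\<forall>i<N. t i \<le> t (Suc i)"
      using t_less by (auto simp: N_def intro!: less_imp_le)
    then show ?thesis
      using P t0 by (auto simp: wiener_measure_def X_def[abs_def])
  qed
  (* The increment is kept as a family over {k}, so that it has the same type as the family Z. *)
  define Y where "Y w = restrict (\<lambda>i. X i w) {k}" for w
  have "indep_var (PiM J (\<lambda>_. borel)) Z (PiM {k} (\<lambda>_. borel)) Y"
    unfolding Z_def[abs_def] Y_def[abs_def] using k_N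
    by (intro indep_var_restrict[OF ind]) (auto simp: J_def)
  then have Z[measurable]: "Z \<in> measurable P (PiM J (\<lambda>_. borel))"
    and Y[measurable]: "Y \<in> measurable P (PiM {k} (\<lambda>_. borel))"
    and joint: "distr P (PiM J (\<lambda>_. borel)) Z \<Otimes>\<^sub>M distr P (PiM {k} (\<lambda>_. borel)) Y =
      distr P (PiM J (\<lambda>_. borel) \<Otimes>\<^sub>M PiM {k} (\<lambda>_. borel)) (\<lambda>w. (Z w, Y w))"
    unfolding indep_var_distribution_eq by auto
  have Y_k: "Y w k = X k w" for w
    by (simp add: Y_def)
  define \<sigma> where "\<sigma> = sqrt (b - a)"
  have \<sigma>: "0 < \<sigma>" "\<sigma>\<^sup>2 = b - a" using ab by (auto simp: \<sigma>_def)
  have distr_Xk: "distributed P lborel (X k) (\<lambda>x. ennreal (normal_density 0 \<sigma> x))"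
    using wiener_increment[OF ab] k b by (simp add: X_def[abs_def] \<sigma>_def)
  define Q where "Q = distr P (PiM J (\<lambda>_. borel :: real measure)) Z"
  have sets_Q[measurable_cong]: "sets Q = sets (PiM J (\<lambda>_. borel))"
    by (simp add: Q_def)
  interpret Q: prob_space Q
    unfolding Q_def by (rule prob_space_distr) (rule Z)
  define N' where "N' = distr P (PiM {k} (\<lambda>_. borel :: real measure)) Y"
  interpret N': prob_space N'
    unfolding N'_def by (rule prob_space_distr) (rule Y)
  interpret QN: pair_sigma_finite Q N' ..
  have disintegrate: "(\<integral>w. g (Z w, X k w) \<partial>P) = (\<integral>z. (\<integral>x. normal_density 0 \<sigma> x * g (z, x) \<partial>lborel) \<partial>Q)"
    if g: "g \<in> borel_measurable (PiM J (\<lambda>_. borel) \<Otimes>\<^sub>M borel)"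
      and int: "integrable P (\<lambda>w. g (Z w, X k w))" for g :: "_ \<Rightarrow> real"
  proof -
    have g'[measurable]: "(\<lambda>(z, y). g (z, y k)) \<in> borel_measurable (PiM J (\<lambda>_. borel) \<Otimes>\<^sub>M PiM {k} (\<lambda>_. borel))"
      unfolding split_def by (rule measurable_compose[OF _ g]) simp
    have "integrable (Q \<Otimes>\<^sub>M N') (\<lambda>(z, y). g (z, y k))"
      unfolding Q_def N'_def joint using int by (simp add: integrable_distr_eq Y_k)
    from QN.integral_fst'[OF this]
    have "(\<integral>z. (\<integral>y. g (z, y k) \<partial>N') \<partial>Q) = (\<integral>w. g (Z w, X k w) \<partial>P)"
      unfolding Q_def N'_def joint by (simp add: integral_distr Y_k)
    moreover have "(\<integral>y. g (z, y k) \<partial>N') = (\<integral>x. normal_density 0 \<sigma> x * g (z, x) \<partial>lborel)"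
      if "z \<in> space Q" for z
    proof -
      have gz: "(\<lambda>x. g (z, x)) \<in> borel_measurable borel"
        using that by (intro measurable_compose[OF measurable_Pair1' g]) (simp add: Q_def)
      then have "(\<lambda>y. g (z, y k)) \<in> borel_measurable (PiM {k} (\<lambda>_. borel))"
        by (rule measurable_compose[rotated]) simp
      then show ?thesis
        using distributed_integral[OF distr_Xk, of "\<lambda>x. g (z, x)"] gz
        by (simp add: N'_def integral_distr Y_k)
    qed
    ultimately show ?thesis
      by (simp cong: Bochner_Integration.integral_cong)
  qed
  define base where "base z s = (\<Sum>i\<in>J. if t i < s then z i else 0)" for z :: "nat \<Rightarrow> real" and s
  define K where "K s = (if b \<le> s then 1 else 0 :: real)" for s
  (* Sum of the increments up to s, with the k-th one split off. *)
  have path: "w s = base (Z w) s + X k w * K s" if "w \<in> paths" "s \<in> U" for w s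
  proof -
    obtain j where j: "j < m" "s = t j" using S_t[of s] \<open>s \<in> U\<close> by (auto simp: S_def)
    have "base (Z w) s = (\<Sum>i\<in>J. if i < j then X i w else 0)"
      unfolding base_def Z_def using j t_less_iff by (intro sum.cong) (auto simp: J_def N_def)
    moreover have "X k w * K s = (if k < j then X k w else 0)"
      using t_le_iff[of "Suc k" j] j b by (auto simp: K_def)
    moreover have "(\<Sum>i<N. if i < j then X i w else 0) =
        (if k < j then X k w else 0) + (\<Sum>i\<in>J. if i < j then X i w else 0)"
      unfolding J_def using k_N by (intro sum.remove) auto
    moreover have "(\<Sum>i<N. if i < j then X i w else 0) = (\<Sum>i<j. X i w)"
      using j by (intro sum.mono_neutral_cong_right) (auto simp: N_def)
    moreover have "(\<Sum>i<j. X i w) = w s"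
      using that j t0 sum_lessThan_telescope[of "\<lambda>i. w (t i)" j] by (simp add: X_def paths_def)
    ultimately show ?thesis by simp
  qed
  have rep: "\<Phi> w = \<Phi> (\<lambda>s. base (Z w) s + X k w * K s)"
      "\<gamma> u w = \<gamma> u (\<lambda>s. base (Z w) s + X k w * K s)" if "w \<in> space P" for w u
    using that path C1_cylinder_cong[OF cyl, of w "\<lambda>s. base (Z w) s + X k w * K s"]
    by (auto simp: wiener_space)
  have curve: "(\<lambda>(z, x) s. base z s + x * K s) \<in>
      measurable (PiM J (\<lambda>_. borel) \<Otimes>\<^sub>M borel) (PiM UNIV (\<lambda>_. borel))"
  proof -
    have "(\<lambda>x. base (fst x) s + snd x * K s) \<in> borel_measurable (PiM J (\<lambda>_. borel) \<Otimes>\<^sub>M borel)" for s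
      unfolding base_def
    proof (intro borel_measurable_add borel_measurable_sum)
      fix i assume "i \<in> J"
      then have "(\<lambda>x. fst x i) \<in> borel_measurable (PiM J (\<lambda>_. borel :: real measure) \<Otimes>\<^sub>M (borel :: real measure))"
        by (intro measurable_compose[OF measurable_fst]) simp
      then show "(\<lambda>x. if t i < s then fst x i else 0) \<in>
          borel_measurable (PiM J (\<lambda>_. borel :: real measure) \<Otimes>\<^sub>M (borel :: real measure))"
        by (cases "t i < s") simp_all
    qed measurable
    then show ?thesis
      unfolding split_def by (intro measurable_PiM_single') auto
  qed
  have "(\<integral>w. \<Phi> w * (w b - w a) \<partial>P) = (\<integral>w. \<Phi> (\<lambda>s. base (Z w) s + X k w * K s) * X k w \<partial>P)"
    using k b by (intro Bochner_Integration.integral_cong arg_cong2[where f="(*)"] rep) (auto simp: X_def)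
  also have "\<dots> = (\<integral>z. (\<integral>x. normal_density 0 \<sigma> x * (\<Phi> (\<lambda>s. base z s + x * K s) * x) \<partial>lborel) \<partial>Q)"
  proof (rule disintegrate[of "\<lambda>(z, x). \<Phi> (\<lambda>s. base z s + x * K s) * x", simplified])
    have "integrable P (\<lambda>w. \<Phi> w * X k w)"
      using wiener_increment_mean(1)[of a b] ab k b
      by (intro integrable_C1_cylinder_mult[OF cyl]) (simp add: X_def[abs_def])
    then show "integrable P (\<lambda>w. \<Phi> (\<lambda>s. base (Z w) s + X k w * K s) * X k w)"
      by (rule Bochner_Integration.integrable_cong[THEN iffD1, rotated -1])
         (auto intro!: arg_cong2[where f="(*)"] rep)
    show "(\<lambda>(z, x). \<Phi> (\<lambda>s. base z s + x * K s) * x) \<in> borel_measurable (PiM J (\<lambda>_. borel) \<Otimes>\<^sub>M borel)"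
      using measurable_compose[OF curve C1_cylinder_measurable[OF cyl]]
      by (auto simp: split_def intro!: borel_measurable_times)
  qed
  also have "\<dots> = (\<integral>z. (b - a) * (\<integral>x. normal_density 0 \<sigma> x * (\<Sum>u\<in>U. \<gamma> u (\<lambda>s. base z s + x * K s) * K u) \<partial>lborel) \<partial>Q)"
  proof (intro Bochner_Integration.integral_cong refl)
    fix z
    obtain C where "\<And>w. \<bar>\<Phi> w\<bar> \<le> C"
      using C1_cylinder_bounded[OF cyl] by (auto simp: bounded_iff)
    then have 1: "bounded (range (\<lambda>x. \<Phi> (\<lambda>s. base z s + x * K s)))"
      by (auto simp: bounded_iff)
    obtain D where D: "\<And>u w. \<bar>\<gamma> u w\<bar> \<le> D u"
      using C1_cylinder_gradient_bounded[OF cyl] by (simp add: bounded_iff) metis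
    have "\<bar>\<Sum>u\<in>U. \<gamma> u (\<lambda>s. base z s + x * K s) * K u\<bar> \<le> (\<Sum>u\<in>U. D u * \<bar>K u\<bar>)" for x
      by (rule order_trans[OF sum_abs]) (auto simp: abs_mult intro!: sum_mono mult_right_mono D)
    then have 2: "bounded (range (\<lambda>x. \<Sum>u\<in>U. \<gamma> u (\<lambda>s. base z s + x * K s) * K u))"
      by (auto simp: bounded_iff)
    have 3: "continuous_on UNIV (\<lambda>x. \<Sum>u\<in>U. \<gamma> u (\<lambda>s. base z s + x * K s) * K u)"
      by (intro continuous_intros C1_cylinder_gradient_continuous[OF cyl])
    show "(\<integral>x. normal_density 0 \<sigma> x * (\<Phi> (\<lambda>s. base z s + x * K s) * x) \<partial>lborel) =
       (b - a) * (\<integral>x. normal_density 0 \<sigma> x * (\<Sum>u\<in>U. \<gamma> u (\<lambda>s. base z s + x * K s) * K u) \<partial>lborel)"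
      using normal_density_integration_by_parts[OF \<sigma>(1) C1_cylinder_deriv[OF cyl] 3 1 2] \<sigma>(2) by simp
  qed
  also have "\<dots> = (b - a) * (\<integral>z. (\<integral>x. normal_density 0 \<sigma> x * (\<Sum>u\<in>U. \<gamma> u (\<lambda>s. base z s + x * K s) * K u) \<partial>lborel) \<partial>Q)"
    by simp
  also have "(\<integral>z. (\<integral>x. normal_density 0 \<sigma> x * (\<Sum>u\<in>U. \<gamma> u (\<lambda>s. base z s + x * K s) * K u) \<partial>lborel) \<partial>Q) =
      (\<integral>w. (\<Sum>u\<in>U. \<gamma> u (\<lambda>s. base (Z w) s + X k w * K s) * K u) \<partial>P)"
  proof (rule disintegrate[of "\<lambda>(z, x). \<Sum>u\<in>U. \<gamma> u (\<lambda>s. base z s + x * K s) * K u", simplified, symmetric])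
    have "integrable P (\<lambda>w. \<Sum>u\<in>U. \<gamma> u w * K u)"
      using C1_cylinder_wiener(4)[OF cyl] by simp
    then show "integrable P (\<lambda>w. \<Sum>u\<in>U. \<gamma> u (\<lambda>s. base (Z w) s + X k w * K s) * K u)"
      by (rule Bochner_Integration.integrable_cong[THEN iffD1, rotated -1])
         (auto intro!: sum.cong arg_cong2[where f="(*)"] rep)
    show "(\<lambda>(z, x). \<Sum>u\<in>U. \<gamma> u (\<lambda>s. base z s + x * K s) * K u) \<in> borel_measurable (PiM J (\<lambda>_. borel) \<Otimes>\<^sub>M borel)"
      using measurable_compose[OF curve C1_cylinder_gradient_measurable[OF cyl]]
      by (auto simp: split_def intro!: borel_measurable_sum borel_measurable_times)
  qed
  also have "\<dots> = (\<integral>w. (\<Sum>u\<in>U. \<gamma> u w * K u) \<partial>P)"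
    by (intro Bochner_Integration.integral_cong sum.cong arg_cong2[where f="(*)"] rep(2)[symmetric] refl)
  also have "\<dots> = (\<Sum>u\<in>U. (\<integral>w. \<gamma> u w \<partial>P) * K u)"
    using C1_cylinder_wiener(4)[OF cyl] by simp
  finally show ?thesis
    by (simp add: sum_distrib_left K_def if_distrib[of "\<lambda>x. _ * x"] ac_simps cong: if_cong)
qed

text \<open>
  \<open>min u b - min u a\<close> is the length of \<open>(a, b] \<inter> (0, u]\<close>. Both sides are additive in the interval, so
  it may be cut at a time of \<open>U\<close> in its interior, until no such time is left.
\<close>

lemma wiener_integration_by_parts_increment:
  assumes cyl: "C1_cylinder U \<Phi> \<gamma>" and "0 \<le> a" "a \<le> b"
  shows "(\<integral>w. \<Phi> w * (w b - w a) \<partial>P) = (\<Sum>u\<in>U. (\<integral>w. \<gamma> u w \<partial>P) * (min u b - min u a))"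
  using assms(2,3)
proof (induction "card (U \<inter> {a<..<b})" arbitrary: a b rule: less_induct)
  case less
  note fin = C1_cylinder_finite[OF cyl]
  consider "a = b" | "a < b" "U \<inter> {a<..<b} = {}" | c where "c \<in> U" "a < c" "c < b"
    using less.prems by fastforce
  then show ?case
  proof cases
    case 1
    then show ?thesis by simp
  next
    case 2
    have "(\<Sum>u\<in>U. (\<integral>w. \<gamma> u w \<partial>P) * (if b \<le> u then b - a else 0)) =
        (\<Sum>u\<in>U. (\<integral>w. \<gamma> u w \<partial>P) * (min u b - min u a))"
      using 2 by (intro sum.cong arg_cong2[where f="(*)"] refl) (auto simp: min_def)
    then show ?thesis
      using wiener_integration_by_parts_gap[OF cyl less.prems(1) 2] by simp
  next
    case 3
    have "card (U \<inter> {a<..<c}) < card (U \<inter> {a<..<b})" "card (U \<inter> {c<..<b}) < card (U \<inter> {a<..<b})"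
      using 3 fin by (intro psubset_card_mono; auto)+
    then have "(\<integral>w. \<Phi> w * (w c - w a) \<partial>P) = (\<Sum>u\<in>U. (\<integral>w. \<gamma> u w \<partial>P) * (min u c - min u a))"
      "(\<integral>w. \<Phi> w * (w b - w c) \<partial>P) = (\<Sum>u\<in>U. (\<integral>w. \<gamma> u w \<partial>P) * (min u b - min u c))"
      using less.hyps[of a c] less.hyps[of c b] less.prems 3 by auto
    moreover have "(\<integral>w. \<Phi> w * (w b - w a) \<partial>P) =
        (\<integral>w. \<Phi> w * (w c - w a) + \<Phi> w * (w b - w c) \<partial>P)"
      by (simp add: algebra_simps)
    moreover have "\<dots> = (\<integral>w. \<Phi> w * (w c - w a) \<partial>P) + (\<integral>w. \<Phi> w * (w b - w c) \<partial>P)"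
      using less.prems 3
      by (intro Bochner_Integration.integral_add integrable_C1_cylinder_mult[OF cyl] wiener_increment_mean) auto
    ultimately show ?thesis
      by (simp add: sum.distrib[symmetric] algebra_simps)
  qed
qed

end

section \<open>Passing to limits in square mean\<close>

text \<open>
  On a finite measure space the \<open>L\<^sup>1\<close> norm is bounded by the \<open>L\<^sup>2\<close> norm (Cauchy-Schwarz against \<open>1\<close>).
\<close>

lemma nn_integral_abs_tendsto_0:
  fixes d :: "nat \<Rightarrow> 'a \<Rightarrow> real"
  assumes "finite_measure M" and [measurable]: "\<And>k. d k \<in> borel_measurable M"
    and lim: "(\<lambda>k. \<integral>\<^sup>+x. ennreal ((d k x)\<^sup>2) \<partial>M) \<longlonglongrightarrow> 0"
  shows "(\<lambda>k. \<integral>\<^sup>+x. ennreal \<bar>d k x\<bar> \<partial>M) \<longlonglongrightarrow> 0"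
proof -
  interpret finite_measure M by fact
  have CS: "(\<integral>\<^sup>+x. ennreal \<bar>d k x\<bar> \<partial>M)\<^sup>2 \<le> emeasure M (space M) * (\<integral>\<^sup>+x. ennreal ((d k x)\<^sup>2) \<partial>M)" for k
    using Cauchy_Schwarz_nn_integral[of "\<lambda>x. ennreal \<bar>d k x\<bar>" M "\<lambda>_. 1"]
    by (simp add: ennreal_power mult.commute)
  have "(\<lambda>k. emeasure M (space M) * (\<integral>\<^sup>+x. ennreal ((d k x)\<^sup>2) \<partial>M)) \<longlonglongrightarrow> emeasure M (space M) * 0"
    using emeasure_finite[of "space M"] by (intro ennreal_tendsto_cmult lim) (metis infinity_ennreal_def top.not_eq_extremum)
  then have *: "(\<lambda>k. emeasure M (space M) * (\<integral>\<^sup>+x. ennreal ((d k x)\<^sup>2) \<partial>M)) \<longlonglongrightarrow> 0"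
    by simp
  have sq: "(\<lambda>k. (\<integral>\<^sup>+x. ennreal \<bar>d k x\<bar> \<partial>M)\<^sup>2) \<longlonglongrightarrow> 0"
    by (rule tendsto_sandwich[OF _ _ tendsto_const *]) (use CS in auto)
  show ?thesis
  proof (rule order_tendstoI)
    fix c :: ennreal assume "0 < c"
    then have "0 < c\<^sup>2" by (simp add: power2_eq_square ennreal_zero_less_mult_iff)
    from order_tendstoD(2)[OF sq this]
    show "\<forall>\<^sub>F k in sequentially. (\<integral>\<^sup>+x. ennreal \<bar>d k x\<bar> \<partial>M) < c"
    proof eventually_elim
      case (elim k)
      show ?case
      proof (rule ccontr)
        assume "\<not> (\<integral>\<^sup>+x. ennreal \<bar>d k x\<bar> \<partial>M) < c"
        then have "c\<^sup>2 \<le> (\<integral>\<^sup>+x. ennreal \<bar>d k x\<bar> \<partial>M)\<^sup>2"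
          unfolding power2_eq_square by (intro mult_mono) (auto simp: not_less)
        with elim show False by simp
      qed
    qed
  qed (simp add: not_less_zero)
qed

lemma L2_limit:
  fixes f :: "nat \<Rightarrow> 'a \<Rightarrow> real"
  assumes M: "finite_measure M" and f: "\<And>k. integrable M (f k)" and g[measurable]: "g \<in> borel_measurable M"
    and lim: "(\<lambda>k. \<integral>\<^sup>+x. ennreal ((f k x - g x)\<^sup>2) \<partial>M) \<longlonglongrightarrow> 0"
    and \<phi>[measurable]: "\<phi> \<in> borel_measurable M" and C: "\<And>x. \<bar>\<phi> x\<bar> \<le> C"
  shows "integrable M g" and "(\<lambda>k. \<integral>x. \<phi> x * f k x \<partial>M) \<longlonglongrightarrow> (\<integral>x. \<phi> x * g x \<partial>M)"
proof -
  note [measurable] = borel_measurable_integrable[OF f]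
  have L1: "(\<lambda>k. \<integral>\<^sup>+x. ennreal \<bar>f k x - g x\<bar> \<partial>M) \<longlonglongrightarrow> 0"
    by (rule nn_integral_abs_tendsto_0[OF M _ lim]) simp
  from order_tendstoD(2)[OF this, of 1]
  obtain k where k: "(\<integral>\<^sup>+x. ennreal \<bar>f k x - g x\<bar> \<partial>M) < 1"
    by (auto simp: eventually_sequentially)
  have "integrable M (\<lambda>x. f k x - (f k x - g x))"
    using k by (intro Bochner_Integration.integrable_diff f integrableI_bounded)
      (auto intro: less_trans simp: ennreal_one_less_top)
  then show g_int: "integrable M g"
    by simp
  have \<phi>_int: "integrable M (\<lambda>x. \<phi> x * h x)" if h: "integrable M h" for h :: "'a \<Rightarrow> real"
  proof (rule Bochner_Integration.integrable_bound)
    show "integrable M (\<lambda>x. C * h x)" using h by simp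
    show "AE x in M. norm (\<phi> x * h x) \<le> norm (C * h x)"
      using order_trans[OF C abs_ge_self] by (auto simp: abs_mult intro!: AE_I2 mult_right_mono)
  qed (use h in simp)
  have C0: "0 \<le> C" using C[of undefined] by linarith
  show "(\<lambda>k. \<integral>x. \<phi> x * f k x \<partial>M) \<longlonglongrightarrow> (\<integral>x. \<phi> x * g x \<partial>M)"
  proof (rule tendsto_L1_int)
    have "(\<lambda>k. ennreal C * (\<integral>\<^sup>+x. ennreal \<bar>f k x - g x\<bar> \<partial>M)) \<longlonglongrightarrow> ennreal C * 0"
      by (intro ennreal_tendsto_cmult L1) simp
    then have *: "(\<lambda>k. ennreal C * (\<integral>\<^sup>+x. ennreal \<bar>f k x - g x\<bar> \<partial>M)) \<longlonglongrightarrow> 0"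
      by simp
    have "(\<integral>\<^sup>+x. ennreal (norm (\<phi> x * f k x - \<phi> x * g x)) \<partial>M) \<le> ennreal C * (\<integral>\<^sup>+x. ennreal \<bar>f k x - g x\<bar> \<partial>M)" for k
    proof -
      have "ennreal (norm (\<phi> x * f k x - \<phi> x * g x)) \<le> ennreal C * ennreal \<bar>f k x - g x\<bar>" for x
        using C[of x] C0 unfolding right_diff_distrib[symmetric]
        by (auto simp: ennreal_mult[symmetric] abs_mult intro!: ennreal_leI mult_right_mono)
      then show ?thesis
        by (subst nn_integral_cmult[symmetric]) (auto intro!: nn_integral_mono)
    qed
    then show "(\<lambda>k. \<integral>\<^sup>+x. ennreal (norm (\<phi> x * f k x - \<phi> x * g x)) \<partial>M) \<longlonglongrightarrow> 0"
      by (intro tendsto_sandwich[OF _ _ tendsto_const *]) auto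
  qed (use f g_int \<phi>_int in auto)
qed

section \<open>Integration by parts against Wiener integrals\<close>

lemma step_fun_simps [simp]:
  "step_fun [] r = 0" "step_fun ((a, s, u) # xs) r = a * indicator {s<..u} r + step_fun xs r"
  "step_integral [] w = 0" "step_integral ((a, s, u) # xs) w = a * (w u - w s) + step_integral xs w"
  "steps_valid []" "steps_valid ((a, s, u) # xs) \<longleftrightarrow> 0 \<le> s \<and> s \<le> u \<and> steps_valid xs"
  by (auto simp: step_fun_def step_integral_def steps_valid_def)

lemma borel_measurable_step_fun [measurable]: "step_fun xs \<in> borel_measurable borel"
proof (induction xs)
  case (Cons x xs)
  then show ?case by (cases x) simp
qed simp

lemma has_bochner_integral_Ioc:
  assumes "a \<le> (b::real)"
  shows "has_bochner_integral lborel (indicator {a<..b}) (b - a)"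
  using assms by (intro has_bochner_integral_real_indicator[THEN has_bochner_integral_cong[THEN iffD1, rotated -1]])
     auto

lemma integral_step_fun:
  assumes "steps_valid xs" "0 \<le> u"
  shows "integrable lborel (\<lambda>r. indicator {0..u} r * step_fun xs r)"
    and "(LBINT r:{0..u}. step_fun xs r) = (\<Sum>(c, a, b)\<leftarrow>xs. c * (min u b - min u a))"
proof -
  have "has_bochner_integral lborel (\<lambda>r. indicator {0..u} r * step_fun xs r) (\<Sum>(c, a, b)\<leftarrow>xs. c * (min u b - min u a))"
    using assms(1)
  proof (induction xs)
    case (Cons x xs)
    obtain c a b where x: "x = (c, a, b)" by (cases x)
    with Cons.prems have ab: "0 \<le> a" "a \<le> b" "steps_valid xs" by auto
    have "has_bochner_integral lborel (indicator {min u a<..min u b}) (min u b - min u a)"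
      using ab by (intro has_bochner_integral_Ioc) auto
    from has_bochner_integral_add[OF has_bochner_integral_mult_right[OF this, of c] Cons.IH[OF ab(3)]]
    have "has_bochner_integral lborel (\<lambda>r. c * indicator {min u a<..min u b} r + indicator {0..u} r * step_fun xs r)
       (\<Sum>(c, a, b)\<leftarrow>x # xs. c * (min u b - min u a))"
      by (simp add: x)
    moreover have "c * indicator {min u a<..min u b} r + indicator {0..u} r * step_fun xs r =
        indicator {0..u} r * step_fun (x # xs) r" for r
      using ab \<open>0 \<le> u\<close> by (auto simp: x indicator_def algebra_simps)
    ultimately show ?case by simp
  qed (simp add: has_bochner_integral_zero)
  then show "integrable lborel (\<lambda>r. indicator {0..u} r * step_fun xs r)"
    and "(LBINT r:{0..u}. step_fun xs r) = (\<Sum>(c, a, b)\<leftarrow>xs. c * (min u b - min u a))"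
    by (auto simp: set_lebesgue_integral_def has_bochner_integral_iff)
qed

context
  fixes P
  assumes P: "wiener_measure P"
begin

interpretation prob_space P
  by (rule wiener_prob_space[OF P])

lemma measurable_step_integral: "step_integral xs \<in> borel_measurable P"
proof (induction xs)
  case (Cons x xs)
  note [measurable] = wiener_measurable_coord[OF P] Cons
  obtain c a b where "x = (c, a, b)" by (cases x)
  then show ?case by simp
qed simp

lemma integrable_step_integral: "steps_valid xs \<Longrightarrow> integrable P (step_integral xs)"
proof (induction xs)
  case (Cons x xs)
  then show ?case
    using wiener_increment_mean(1)[OF P] by (cases x) auto
next
  case Nil
  have "step_integral [] = (\<lambda>_. 0)"
    by (simp add: fun_eq_iff)
  then show ?case
    by simp
qed

lemma step_integral_integration_by_parts:
  assumes cyl: "C1_cylinder U \<Phi> \<gamma>" and "steps_valid xs"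
  shows "(\<integral>w. \<Phi> w * step_integral xs w \<partial>P) = (\<Sum>u\<in>U. (\<integral>w. \<gamma> u w \<partial>P) * (LBINT r:{0..u}. step_fun xs r))"
proof -
  have "(\<integral>w. \<Phi> w * step_integral xs w \<partial>P) =
      (\<Sum>u\<in>U. (\<integral>w. \<gamma> u w \<partial>P) * (\<Sum>(c, a, b)\<leftarrow>xs. c * (min u b - min u a)))"
    using assms(2)
  proof (induction xs)
    case (Cons x xs)
    obtain c a b where x: "x = (c, a, b)" by (cases x)
    with Cons.prems have ab: "0 \<le> a" "a \<le> b" "steps_valid xs" by auto
    have "(\<integral>w. \<Phi> w * step_integral (x # xs) w \<partial>P) =
        (\<integral>w. c * (\<Phi> w * (w b - w a)) + \<Phi> w * step_integral xs w \<partial>P)"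
      by (simp add: x algebra_simps)
    also have "\<dots> = c * (\<integral>w. \<Phi> w * (w b - w a) \<partial>P) + (\<integral>w. \<Phi> w * step_integral xs w \<partial>P)"
      using integrable_C1_cylinder_mult[OF P cyl wiener_increment_mean(1)[OF P ab(1,2)]]
        integrable_C1_cylinder_mult[OF P cyl integrable_step_integral[OF ab(3)]]
      by simp
    also have "\<dots> = (\<Sum>u\<in>U. (\<integral>w. \<gamma> u w \<partial>P) * (\<Sum>(c, a, b)\<leftarrow>x # xs. c * (min u b - min u a)))"
      unfolding wiener_integration_by_parts_increment[OF P cyl ab(1,2)] Cons.IH[OF ab(3)]
      by (simp add: x sum_distrib_left sum.distrib[symmetric] algebra_simps)
    finally show ?case .
  qed simp
  also have "\<dots> = (\<Sum>u\<in>U. (\<integral>w. \<gamma> u w \<partial>P) * (LBINT r:{0..u}. step_fun xs r))"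
    using C1_cylinder_nonneg[OF cyl] integral_step_fun(2)[OF assms(2)]
    by (intro sum.cong refl) auto
  finally show ?thesis .
qed

text \<open>
  The approximating step functions converge to \<open>f\<close> in \<open>L\<^sup>2\<close>, hence in \<open>L\<^sup>1\<close> on each bounded interval
  \<open>[0, u]\<close>, and their integrals converge to \<open>X\<close> in \<open>L\<^sup>2(P)\<close>, hence in \<open>L\<^sup>1(P)\<close>. This is all that
  is needed to pass to the limit in the identity for step functions.
\<close>

theorem wiener_integral_integration_by_parts:
  assumes cyl: "C1_cylinder U \<Phi> \<gamma>" and X: "is_wiener_integral P f X"
    and f[measurable]: "f \<in> borel_measurable lebesgue_Rplus"
  shows "integrable P X"
    and "(\<integral>w. \<Phi> w * X w \<partial>P) = (\<Sum>u\<in>U. (\<integral>w. \<gamma> u w \<partial>P) * (LBINT r:{0..u}. f r))"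
proof -
  obtain xs where xs: "\<And>k. steps_valid (xs k)"
    and lim_f: "(\<lambda>k. \<integral>\<^sup>+r. ennreal ((step_fun (xs k) r - f r)\<^sup>2) \<partial>lebesgue_Rplus) \<longlonglongrightarrow> 0"
    and lim_X: "(\<lambda>k. \<integral>\<^sup>+w. ennreal ((step_integral (xs k) w - X w)\<^sup>2) \<partial>P) \<longlonglongrightarrow> 0"
    using X unfolding is_wiener_integral_def by blast
  have X_meas: "X \<in> borel_measurable P"
    using X by (simp add: is_wiener_integral_def)
  obtain C where C: "\<And>w. \<bar>\<Phi> w\<bar> \<le> C"
    using C1_cylinder_bounded[OF cyl] by (auto simp: bounded_iff)
  note L = L2_limit[OF finite_measure_axioms integrable_step_integral[OF xs] X_meas lim_X
      C1_cylinder_wiener(1)[OF P cyl] C]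
  show "integrable P X"
    by (rule L(1))
  have lim_u: "(\<lambda>k. LBINT r:{0..u}. step_fun (xs k) r) \<longlonglongrightarrow> (LBINT r:{0..u}. f r)" if "0 \<le> u" for u
  proof -
    let ?M = "restrict_space lborel {0..u}"
    have M: "finite_measure ?M"
      by (rule finite_measureI) (simp add: emeasure_restrict_space space_restrict_space that)
    have 1: "integrable ?M (step_fun (xs k))" for k
      using integral_step_fun(1)[OF xs that] by (simp add: integrable_restrict_space)
    have 2: "f \<in> borel_measurable ?M"
    proof -
      have "f \<in> borel_measurable (restrict_space lebesgue_Rplus {0..u})"
        by (rule measurable_restrict_space1[OF f])
      also have "restrict_space lebesgue_Rplus {0..u} = ?M"
        by (subst restrict_restrict_space) (auto intro: arg_cong2[where f=restrict_space])
      finally show ?thesis .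
    qed
    have 3: "(\<lambda>k. \<integral>\<^sup>+r. ennreal ((step_fun (xs k) r - f r)\<^sup>2) \<partial>?M) \<longlonglongrightarrow> 0"
    proof (rule tendsto_sandwich[OF _ _ tendsto_const lim_f])
      have "(\<integral>\<^sup>+r. ennreal ((step_fun (xs k) r - f r)\<^sup>2) \<partial>?M) \<le>
          (\<integral>\<^sup>+r. ennreal ((step_fun (xs k) r - f r)\<^sup>2) \<partial>lebesgue_Rplus)" for k
        by (simp add: nn_integral_restrict_space) (auto intro!: nn_integral_mono simp: indicator_def)
      then show "\<forall>\<^sub>F k in sequentially. (\<integral>\<^sup>+r. ennreal ((step_fun (xs k) r - f r)\<^sup>2) \<partial>?M) \<le>
          (\<integral>\<^sup>+r. ennreal ((step_fun (xs k) r - f r)\<^sup>2) \<partial>lebesgue_Rplus)"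
        by simp
    qed simp
    from L2_limit(2)[OF M 1 2 3, of "\<lambda>_. 1" 1]
    show ?thesis
      by (simp add: integral_restrict_space set_lebesgue_integral_def)
  qed
  have "(\<lambda>k. \<integral>w. \<Phi> w * step_integral (xs k) w \<partial>P) \<longlonglongrightarrow>
      (\<Sum>u\<in>U. (\<integral>w. \<gamma> u w \<partial>P) * (LBINT r:{0..u}. f r))"
    unfolding step_integral_integration_by_parts[OF cyl xs]
    using C1_cylinder_nonneg[OF cyl] by (intro tendsto_intros lim_u) auto
  then show "(\<integral>w. \<Phi> w * X w \<partial>P) = (\<Sum>u\<in>U. (\<integral>w. \<gamma> u w \<partial>P) * (LBINT r:{0..u}. f r))"
    by (rule LIMSEQ_unique[OF L(2)])
qed

section \<open>A second moment bound for Wiener integrals\<close>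

text \<open>
  For \<open>s \<le> t\<close> write \<open>w s * w t = w s * (w t - w s) + (w s)\<^sup>2\<close>; the first product has mean \<open>0\<close> by
  independence of increments.
\<close>

lemma wiener_covariance:
  assumes "0 \<le> s" "0 \<le> t"
  shows "integrable P (\<lambda>w. w s * w t)" and "(\<integral>w. w s * w t \<partial>P) = min s t"
proof -
  have sq: "integrable P (\<lambda>w. (w s)\<^sup>2) \<and> (\<integral>w. (w s)\<^sup>2 \<partial>P) = s" if "0 \<le> s" for s
  proof -
    have "integrable P (\<lambda>w. (w s)\<^sup>2) \<longleftrightarrow> integrable P (\<lambda>w. (w s - w 0)\<^sup>2)"
      "(\<integral>w. (w s)\<^sup>2 \<partial>P) = (\<integral>w. (w s - w 0)\<^sup>2 \<partial>P)"
      by (auto intro!: Bochner_Integration.integrable_cong Bochner_Integration.integral_cong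
          simp: wiener_space[OF P] paths_def)
    then show ?thesis
      using wiener_increment_square[OF P order_refl that] by simp
  qed
  have *: "integrable P (\<lambda>w. w s * w t) \<and> (\<integral>w. w s * w t \<partial>P) = s" if st: "0 \<le> s" "s \<le> t" for s t
  proof -
    (* The partition 0, s, t; the two factors of the product below are its increments. *)
    define p where "p i = (if i = 0 then 0 else if i = Suc 0 then s else t)" for i
    have "0 \<le> p 0 \<longrightarrow> (\<forall>i<2. p i \<le> p (Suc i)) \<longrightarrow>
        indep_vars (\<lambda>_. borel) (\<lambda>i w. w (p (Suc i)) - w (p i)) {..<2::nat}"
      using P unfolding wiener_measure_def by blast
    then have "indep_vars (\<lambda>_. borel) (\<lambda>i w. w (p (Suc i)) - w (p i)) {..<2::nat}"
      using st by (simp add: p_def less_2_cases_iff)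
    moreover have "integrable P (\<lambda>w. w (p (Suc i)) - w (p i))" for i
      using wiener_increment_mean(1)[OF P, of "p i" "p (Suc i)"] st by (auto simp: p_def)
    ultimately have I: "integrable P (\<lambda>w. \<Prod>i<2. w (p (Suc i)) - w (p i))"
      "(\<integral>w. (\<Prod>i<2. w (p (Suc i)) - w (p i)) \<partial>P) = (\<Prod>i<2. \<integral>w. w (p (Suc i)) - w (p i) \<partial>P)"
      by (auto intro!: indep_vars_integrable indep_vars_lebesgue_integral)
    have "(\<Prod>i<2. w (p (Suc i)) - w (p i)) + (w s)\<^sup>2 = w s * w t" if "w \<in> space P" for w
      using that by (simp add: wiener_space[OF P] paths_def p_def numeral_2_eq_2 algebra_simps power2_eq_square)
    moreover have "integrable P (\<lambda>w. (\<Prod>i<2. w (p (Suc i)) - w (p i)) + (w s)\<^sup>2)"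
      using I(1) sq[OF st(1)] by simp
    moreover have "(\<integral>w. (\<Prod>i<2. w (p (Suc i)) - w (p i)) + (w s)\<^sup>2 \<partial>P) = s"
      using I sq[OF st(1)] wiener_increment_mean(2)[OF P st] by (simp add: p_def numeral_2_eq_2)
    ultimately show ?thesis
      by (simp cong: Bochner_Integration.integral_cong Bochner_Integration.integrable_cong)
  qed
  show "integrable P (\<lambda>w. w s * w t)" "(\<integral>w. w s * w t \<partial>P) = min s t"
    using *[of s t] *[of t s] assms by (cases "s \<le> t"; simp add: min_def mult.commute)+
qed

lemma wiener_increment_covariance:
  assumes "0 \<le> a" "a \<le> b" "0 \<le> c" "c \<le> d"
  shows "integrable P (\<lambda>w. (w b - w a) * (w d - w c))"
    and "(\<integral>w. (w b - w a) * (w d - w c) \<partial>P) = (\<integral>r. indicator {a<..b} r * indicator {c<..d} r \<partial>lborel)"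
proof -
  have eq: "(\<lambda>w :: real \<Rightarrow> real. (w b - w a) * (w d - w c)) = (\<lambda>w. w b * w d - w b * w c - w a * w d + w a * w c)"
    by (auto simp: algebra_simps)
  show "integrable P (\<lambda>w. (w b - w a) * (w d - w c))"
    unfolding eq using assms by (intro Bochner_Integration.integrable_add Bochner_Integration.integrable_diff wiener_covariance) auto
  have "(\<integral>w. (w b - w a) * (w d - w c) \<partial>P) = min b d - min b c - min a d + min a c"
    unfolding eq using assms wiener_covariance by simp
  also have "\<dots> = max 0 (min b d - max a c)"
    using assms by (auto simp: min_def max_def)
  also have "\<dots> = measure lborel {max a c<..min b d}"
    by (cases "max a c \<le> min b d") (auto simp: max_def)
  also have "\<dots> = (\<integral>r. indicator {max a c<..min b d} r \<partial>lborel)"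
    by simp
  also have "\<dots> = (\<integral>r. indicator {a<..b} r * indicator {c<..d} r \<partial>lborel)"
    by (intro Bochner_Integration.integral_cong) (auto simp: indicator_def)
  finally show "(\<integral>w. (w b - w a) * (w d - w c) \<partial>P) = (\<integral>r. indicator {a<..b} r * indicator {c<..d} r \<partial>lborel)" .
qed

text \<open>
  Stated for two lists, since both sides are bilinear and can then be expanded one list at a time.
\<close>

lemma step_integral_isometry:
  assumes "steps_valid xs" "steps_valid ys"
  shows "integrable P (\<lambda>w. step_integral xs w * step_integral ys w)"
    and "integrable lborel (\<lambda>r. step_fun xs r * step_fun ys r)"
    and "(\<integral>w. step_integral xs w * step_integral ys w \<partial>P) = (\<integral>r. step_fun xs r * step_fun ys r \<partial>lborel)"
proof -
  have ind: "integrable lborel (\<lambda>r. indicator {a<..b} r * indicator {c<..d} r :: real)" for a b c d :: real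
  proof -
    have "emeasure lborel ({a<..b} \<inter> {c<..d}) \<le> emeasure lborel {a<..b}"
      by (rule emeasure_mono) auto
    also have "\<dots> < \<infinity>" by (cases "a \<le> b") auto
    finally show ?thesis
      unfolding indicator_inter_arith[symmetric] by (intro integrable_real_indicator) auto
  qed
  have one: "integrable P (\<lambda>w. (w b - w a) * step_integral ys w) \<and>
      integrable lborel (\<lambda>r. indicator {a<..b} r * step_fun ys r) \<and>
      (\<integral>w. (w b - w a) * step_integral ys w \<partial>P) = (\<integral>r. indicator {a<..b} r * step_fun ys r \<partial>lborel)"
    if ab: "0 \<le> a" "a \<le> b" for a b
    using assms(2)
  proof (induction ys)
    case (Cons y ys)
    obtain e c d where y: "y = (e, c, d)" by (cases y)
    with Cons.prems have cd: "0 \<le> c" "c \<le> d" "steps_valid ys" by auto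
    have 1: "(\<lambda>w. (w b - w a) * step_integral (y # ys) w) =
        (\<lambda>w. e * ((w b - w a) * (w d - w c)) + (w b - w a) * step_integral ys w)"
      by (auto simp: y algebra_simps)
    have 2: "(\<lambda>r. indicator {a<..b} r * step_fun (y # ys) r) =
        (\<lambda>r. e * (indicator {a<..b} r * indicator {c<..d} r) + indicator {a<..b} r * step_fun ys r)"
      by (auto simp: y algebra_simps)
    show ?case
      unfolding 1 2 using Cons.IH[OF cd(3)] wiener_increment_covariance[OF ab cd(1,2)] ind by simp
  qed simp
  have "integrable P (\<lambda>w. step_integral xs w * step_integral ys w) \<and>
    integrable lborel (\<lambda>r. step_fun xs r * step_fun ys r) \<and>
    (\<integral>w. step_integral xs w * step_integral ys w \<partial>P) = (\<integral>r. step_fun xs r * step_fun ys r \<partial>lborel)"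
    using assms(1)
  proof (induction xs)
    case (Cons x xs)
    obtain e a b where x: "x = (e, a, b)" by (cases x)
    with Cons.prems have ab: "0 \<le> a" "a \<le> b" "steps_valid xs" by auto
    have 1: "(\<lambda>w. step_integral (x # xs) w * step_integral ys w) =
        (\<lambda>w. e * ((w b - w a) * step_integral ys w) + step_integral xs w * step_integral ys w)"
      by (auto simp: x algebra_simps)
    have 2: "(\<lambda>r. step_fun (x # xs) r * step_fun ys r) =
        (\<lambda>r. e * (indicator {a<..b} r * step_fun ys r) + step_fun xs r * step_fun ys r)"
      by (auto simp: x algebra_simps)
    show ?case
      unfolding 1 2 using Cons.IH[OF ab(3)] one[OF ab(1,2)] by simp
  qed simp
  then show "integrable P (\<lambda>w. step_integral xs w * step_integral ys w)"
    and "integrable lborel (\<lambda>r. step_fun xs r * step_fun ys r)"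
    and "(\<integral>w. step_integral xs w * step_integral ys w \<partial>P) = (\<integral>r. step_fun xs r * step_fun ys r \<partial>lborel)"
    by auto
qed

lemma step_fun_neg: "steps_valid xs \<Longrightarrow> r < 0 \<Longrightarrow> step_fun xs r = 0"
proof (induction xs)
  case (Cons x xs)
  then show ?case by (cases x) auto
qed simp

lemma nn_integral_square_le:
  fixes f g :: "'a \<Rightarrow> real"
  assumes [measurable]: "f \<in> borel_measurable M" "g \<in> borel_measurable M"
  shows "(\<integral>\<^sup>+x. ennreal ((g x)\<^sup>2) \<partial>M) \<le>
    2 * (\<integral>\<^sup>+x. ennreal ((f x - g x)\<^sup>2) \<partial>M) + 2 * (\<integral>\<^sup>+x. ennreal ((f x)\<^sup>2) \<partial>M)"
proof -
  have "(g x)\<^sup>2 \<le> 2 * (f x - g x)\<^sup>2 + 2 * (f x)\<^sup>2" for x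
    using sum_squares_ge_zero[of "2 * f x - g x" 0] by (simp add: power2_eq_square algebra_simps)
  then have "ennreal ((g x)\<^sup>2) \<le> 2 * ennreal ((f x - g x)\<^sup>2) + 2 * ennreal ((f x)\<^sup>2)" for x
    by (subst ennreal_numeral[symmetric])+ (simp add: ennreal_mult[symmetric] ennreal_plus[symmetric] ennreal_leI del: ennreal_plus ennreal_numeral)
  then have "(\<integral>\<^sup>+x. ennreal ((g x)\<^sup>2) \<partial>M) \<le> (\<integral>\<^sup>+x. 2 * ennreal ((f x - g x)\<^sup>2) + 2 * ennreal ((f x)\<^sup>2) \<partial>M)"
    by (rule nn_integral_mono)
  also have "\<dots> = 2 * (\<integral>\<^sup>+x. ennreal ((f x - g x)\<^sup>2) \<partial>M) + 2 * (\<integral>\<^sup>+x. ennreal ((f x)\<^sup>2) \<partial>M)"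
    by (simp add: nn_integral_add nn_integral_cmult)
  finally show ?thesis .
qed

text \<open>
  The inequality \<open>x\<^sup>2 \<le> 2 (x - y)\<^sup>2 + 2 y\<^sup>2\<close>, used once for \<open>X\<close> and once for the step functions,
  carries the isometry over to the limit up to the factor \<open>4\<close>, without any convergence of norms.
\<close>

lemma wiener_integral_L2_bound:
  assumes X: "is_wiener_integral P f X" and f[measurable]: "f \<in> borel_measurable lebesgue_Rplus"
  shows "(\<integral>\<^sup>+w. ennreal ((X w)\<^sup>2) \<partial>P) \<le> 4 * (\<integral>\<^sup>+r. ennreal ((f r)\<^sup>2) \<partial>lebesgue_Rplus)"
proof -
  obtain xs where xs: "\<And>k. steps_valid (xs k)"
    and lim_f: "(\<lambda>k. \<integral>\<^sup>+r. ennreal ((step_fun (xs k) r - f r)\<^sup>2) \<partial>lebesgue_Rplus) \<longlonglongrightarrow> 0"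
    and lim_X: "(\<lambda>k. \<integral>\<^sup>+w. ennreal ((step_integral (xs k) w - X w)\<^sup>2) \<partial>P) \<longlonglongrightarrow> 0"
    using X unfolding is_wiener_integral_def by blast
  have [measurable]: "X \<in> borel_measurable P"
    using X by (simp add: is_wiener_integral_def)
  note [measurable] = measurable_step_integral
  have [measurable]: "step_fun (xs k) \<in> borel_measurable lebesgue_Rplus" for k
    by (rule measurable_restrict_space1) simp
  let ?A = "\<lambda>k. \<integral>\<^sup>+w. ennreal ((step_integral (xs k) w - X w)\<^sup>2) \<partial>P"
  let ?B = "\<lambda>k. \<integral>\<^sup>+r. ennreal ((step_fun (xs k) r - f r)\<^sup>2) \<partial>lebesgue_Rplus"
  let ?f = "\<integral>\<^sup>+r. ennreal ((f r)\<^sup>2) \<partial>lebesgue_Rplus"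
  have iso: "(\<integral>\<^sup>+w. ennreal ((step_integral (xs k) w)\<^sup>2) \<partial>P) =
      (\<integral>\<^sup>+r. ennreal ((step_fun (xs k) r)\<^sup>2) \<partial>lebesgue_Rplus)" for k
  proof -
    have "(\<integral>\<^sup>+w. ennreal ((step_integral (xs k) w)\<^sup>2) \<partial>P) = (\<integral>\<^sup>+r. ennreal ((step_fun (xs k) r)\<^sup>2) \<partial>lborel)"
      using step_integral_isometry[OF xs xs, of k k]
      by (simp add: power2_eq_square nn_integral_eq_integral)
    also have "\<dots> = (\<integral>\<^sup>+r. ennreal ((step_fun (xs k) r)\<^sup>2) \<partial>lebesgue_Rplus)"
      using step_fun_neg[OF xs, of _ k]
      by (subst nn_integral_restrict_space) (auto intro!: nn_integral_cong simp: indicator_def not_le)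
    finally show ?thesis .
  qed
  have "(\<integral>\<^sup>+w. ennreal ((X w)\<^sup>2) \<partial>P) \<le> 2 * ?A k + 2 * (2 * ?B k + 2 * ?f)" for k
  proof -
    have "(\<integral>\<^sup>+w. ennreal ((X w)\<^sup>2) \<partial>P) \<le> 2 * ?A k + 2 * (\<integral>\<^sup>+w. ennreal ((step_integral (xs k) w)\<^sup>2) \<partial>P)"
      by (rule nn_integral_square_le) simp_all
    moreover have "(\<integral>\<^sup>+w. ennreal ((step_integral (xs k) w)\<^sup>2) \<partial>P) \<le> 2 * ?B k + 2 * ?f"
      unfolding iso using nn_integral_square_le[of f lebesgue_Rplus "step_fun (xs k)"]
      unfolding power2_commute[of "f r" "step_fun (xs k) r" for r] by simp
    ultimately show ?thesis
      by (elim order_trans[OF _ add_left_mono[OF mult_left_mono]]) simp_all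
  qed
  moreover have "(\<lambda>k. 2 * ?A k + 2 * (2 * ?B k + 2 * ?f)) \<longlonglongrightarrow> 2 * 0 + 2 * (2 * 0 + 2 * ?f)"
    by (intro tendsto_add ennreal_tendsto_cmult lim_X lim_f tendsto_const) auto
  ultimately have "(\<integral>\<^sup>+w. ennreal ((X w)\<^sup>2) \<partial>P) \<le> 2 * 0 + 2 * (2 * 0 + 2 * ?f)"
    by (intro LIMSEQ_le_const) auto
  also have "\<dots> = 4 * ?f"
    by (simp add: mult.assoc[symmetric])
  finally show ?thesis .
qed

end

section \<open>The first moment of the random time\<close>

text \<open>
  On \<open>[1, 2]\<close> there is a positive minimum by compactness, and \<open>Gamma x = (x - 1) Gamma (x - 1)\<close> shows
  that moving right by \<open>1\<close> from a point \<open>x - 1 \<ge> 1\<close> does not decrease the value.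
\<close>

lemma Gamma_real_lower_bound: "\<exists>c>0. \<forall>x\<ge>1. c \<le> Gamma (x::real)"
proof -
  have "continuous_on {1..2::real} Gamma"
    by (intro continuous_on_Gamma) (auto elim!: nonpos_Ints_cases)
  from continuous_attains_inf[OF compact_Icc _ this]
  obtain y :: real where y: "y \<in> {1..2}" "\<And>x. x \<in> {1..2} \<Longrightarrow> Gamma y \<le> Gamma x"
    by auto
  have pos: "0 < Gamma y"
    using y by (intro Gamma_real_pos) auto
  have "Gamma y \<le> Gamma x" if "1 \<le> x" "x \<le> 2 + real n" for x n
    using that
  proof (induction n arbitrary: x)
    case 0
    then show ?case using y by auto
  next
    case (Suc n)
    show ?case
    proof (cases "x \<le> 2")
      case True
      then show ?thesis using y Suc.prems by auto
    next
      case False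
      then have "Gamma y \<le> Gamma (x - 1)"
        using Suc by auto
      also have "\<dots> \<le> (x - 1) * Gamma (x - 1)"
        using False Gamma_real_pos[of "x - 1"] by simp
      also have "\<dots> = Gamma x"
      proof -
        have "x - 1 \<notin> \<int>\<^sub>\<le>\<^sub>0"
          using False by (auto elim!: nonpos_Ints_cases)
        from Gamma_plus1[OF this] show ?thesis
          by simp
      qed
      finally show ?thesis .
    qed
  qed
  moreover have "\<exists>n. x \<le> 2 + real n" for x
    using real_arch_simple[of "x - 2"] by (auto simp: algebra_simps)
  ultimately show ?thesis
    using pos by blast
qed

text \<open>
  The coefficients \<open>1 / Gamma (\<beta> n + 1)\<close> are bounded, so for \<open>s \<le> 1 / 2\<close> the terms with \<open>n \<ge> 1\<close> are
  dominated by a geometric series with sum of order \<open>s\<close>. The bound says that the Laplace transform of the random time has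
  a finite slope at \<open>0\<close>.
\<close>

lemma mittag_leffler_lower_bound:
  assumes "0 < \<beta>"
  obtains C where "0 \<le> C" "\<And>s. 0 \<le> s \<Longrightarrow> s \<le> 1 / 2 \<Longrightarrow> 1 - mittag_leffler \<beta> (- s) \<le> C * s"
proof -
  obtain c where c: "0 < c" "\<And>x. 1 \<le> x \<Longrightarrow> c \<le> Gamma (x::real)"
    using Gamma_real_lower_bound by blast
  have "1 - mittag_leffler \<beta> (- s) \<le> 2 / c * s" if s: "0 \<le> s" "s \<le> 1 / 2" for s
  proof -
    define a where "a n = (- s) ^ n / Gamma (\<beta> * real n + 1)" for n
    have a_le: "\<bar>a n\<bar> \<le> s ^ n / c" for n
    proof -
      have "c \<le> Gamma (\<beta> * real n + 1)"
        using assms by (intro c) simp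
      then show ?thesis
        using s c(1) by (simp add: a_def power_abs frac_le)
    qed
    have geom: "(\<lambda>n. s ^ n / c) sums (1 / (1 - s) / c)"
      using s by (intro sums_divide geometric_sums) auto
    have summ: "summable a"
      using a_le by (intro summable_comparison_test'[OF sums_summable[OF geom]]) auto
    have "mittag_leffler \<beta> (- s) = suminf a"
      by (simp add: mittag_leffler_def a_def[abs_def])
    also have "\<dots> = (\<Sum>n. a (Suc n)) + a 0"
      using suminf_split_head[OF summ] by simp
    finally have "1 - mittag_leffler \<beta> (- s) = - (\<Sum>n. a (Suc n))"
      by (simp add: a_def)
    also have "\<dots> = (\<Sum>n. - a (Suc n))"
      using summ by (intro suminf_minus[symmetric]) (simp add: summable_Suc_iff)
    also have "\<dots> \<le> (\<Sum>n. s * (s ^ n / c))"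
    proof (rule suminf_le)
      show "- a (Suc n) \<le> s * (s ^ n / c)" for n
        using a_le[of "Suc n"] by simp
      show "summable (\<lambda>n. - a (Suc n))"
        using summ by (simp add: summable_Suc_iff summable_minus)
      show "summable (\<lambda>n. s * (s ^ n / c))"
        by (intro summable_mult sums_summable[OF geom])
    qed
    also have "\<dots> = s * (1 / (1 - s) / c)"
      using sums_mult[OF geom, of s] by (simp add: sums_iff)
    also have "\<dots> \<le> s * (2 / c)"
      using s c(1) by (intro mult_left_mono divide_right_mono) (auto simp: field_simps)
    finally show ?thesis by (simp add: mult.commute)
  qed
  then show ?thesis
    using c(1) by (intro that[of "2 / c"]) auto
qed

lemma sets_law_of_density: "sets (law_of_density M) = sets lebesgue_Rplus"
  and space_law_of_density: "space (law_of_density M) = {0..}"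
  by (simp_all add: law_of_density_def space_restrict_space)

lemma measurable_law_of_density_id: "(\<lambda>\<tau>. \<tau>) \<in> borel_measurable (law_of_density M)"
  by (subst measurable_cong_sets[OF sets_law_of_density refl]) (rule measurable_restrict_space1, simp)

lemma M_density_prob_space:
  assumes "is_M_density \<beta> M"
  shows "integrable lebesgue_Rplus M" and "(\<integral>\<tau>. M \<tau> \<partial>lebesgue_Rplus) = 1"
    and "prob_space (law_of_density M)"
proof -
  have [measurable]: "M \<in> borel_measurable lebesgue_Rplus"
    using assms by (simp add: is_M_density_def)
  have "(\<integral>\<tau>. exp (- 0 * \<tau>) * M \<tau> \<partial>lebesgue_Rplus) = mittag_leffler \<beta> (- 0)"
    using assms unfolding is_M_density_def by blast
  moreover have "mittag_leffler \<beta> 0 = 1"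
    unfolding mittag_leffler_def by (subst suminf_finite[of "{0}"]) auto
  ultimately show 1: "(\<integral>\<tau>. M \<tau> \<partial>lebesgue_Rplus) = 1"
    by simp
  then show int: "integrable lebesgue_Rplus M"
    using not_integrable_integral_eq by force
  have "(\<integral>\<^sup>+\<tau>. ennreal (M \<tau>) \<partial>lebesgue_Rplus) = 1"
    using assms by (subst nn_integral_eq_integral[OF int])
      (auto simp: 1 is_M_density_def space_restrict_space)
  moreover have "(\<integral>\<^sup>+\<tau>. ennreal (M \<tau>) * indicator (space lebesgue_Rplus) \<tau> \<partial>lebesgue_Rplus) =
      (\<integral>\<^sup>+\<tau>. ennreal (M \<tau>) \<partial>lebesgue_Rplus)"
    by (intro nn_integral_cong) simp
  ultimately show "prob_space (law_of_density M)"
    unfolding law_of_density_def using sets.top[of lebesgue_Rplus]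
    by (intro prob_spaceI, unfold space_density, subst emeasure_density) simp_all
qed

text \<open>
  \<open>(1 - exp (- s \<tau>)) / s\<close> tends to \<open>\<tau>\<close> as \<open>s \<rightarrow> 0\<close>, and its integral \<open>(1 - mittag_leffler \<beta> (- s)) / s\<close>
  stays bounded. Fatou's lemma does the rest.
\<close>

lemma M_density_first_moment:
  assumes \<beta>: "0 < \<beta>" and M: "is_M_density \<beta> M"
  shows "(\<integral>\<^sup>+\<tau>. ennreal \<tau> \<partial>law_of_density M) < \<infinity>"
proof -
  obtain C where C: "0 \<le> C" "\<And>s. 0 \<le> s \<Longrightarrow> s \<le> 1 / 2 \<Longrightarrow> 1 - mittag_leffler \<beta> (- s) \<le> C * s"
    using mittag_leffler_lower_bound[OF \<beta>] by blast
  have meas[measurable]: "M \<in> borel_measurable lebesgue_Rplus"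
    and nonneg: "\<And>\<tau>. 0 \<le> \<tau> \<Longrightarrow> 0 \<le> M \<tau>"
    and laplace: "\<And>s. 0 \<le> s \<Longrightarrow> (\<integral>\<tau>. exp (- s * \<tau>) * M \<tau> \<partial>lebesgue_Rplus) = mittag_leffler \<beta> (- s)"
    using M by (auto simp: is_M_density_def)
  have id[measurable]: "(\<lambda>\<tau>. \<tau>) \<in> borel_measurable lebesgue_Rplus"
    by (rule measurable_restrict_space1) simp
  note int = M_density_prob_space(1)[OF M]
  (* The shift by two keeps s n within the range s n \<le> 1 / 2 of the bound for C. *)
  define s where "s n = inverse (real (Suc (Suc n)))" for n
  have s: "0 < s n" "s n \<le> 1 / 2" for n
    by (auto simp: s_def field_simps)
  have s_lim: "s \<longlonglongrightarrow> 0"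
    using LIMSEQ_Suc[OF LIMSEQ_inverse_real_of_nat] by (simp add: s_def[abs_def])
  let ?f = "\<lambda>n \<tau>. (1 - exp (- s n * \<tau>)) / s n * M \<tau>"
  have f_lim: "(\<lambda>n. ?f n \<tau>) \<longlonglongrightarrow> \<tau> * M \<tau>" for \<tau>
  proof -
    have "((\<lambda>x. - exp (- x * \<tau>)) has_real_derivative \<tau>) (at 0)"
      by (auto intro!: derivative_eq_intros)
    then have "((\<lambda>x. (1 - exp (- x * \<tau>)) / x) \<longlongrightarrow> \<tau>) (at 0)"
      by (simp add: DERIV_def)
    moreover have "filterlim s (at 0) sequentially"
      using s_lim s(1) by (simp add: filterlim_at less_imp_neq[symmetric])
    ultimately have "(\<lambda>n. (1 - exp (- s n * \<tau>)) / s n) \<longlonglongrightarrow> \<tau>"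
      by (rule filterlim_compose)
    then show ?thesis
      by (intro tendsto_mult tendsto_const)
  qed
  have f_int: "(\<integral>\<^sup>+\<tau>. ennreal (?f n \<tau>) \<partial>lebesgue_Rplus) \<le> ennreal C" for n
  proof -
    have exp_int: "integrable lebesgue_Rplus (\<lambda>\<tau>. exp (- s n * \<tau>) * M \<tau>)"
      by (rule Bochner_Integration.integrable_bound[OF int])
         (use s(1)[of n] in \<open>auto simp: space_restrict_space abs_mult intro!: AE_I2 mult_left_le_one_le\<close>)
    have eq: "?f n \<tau> = 1 / s n * (M \<tau> - exp (- s n * \<tau>) * M \<tau>)" for \<tau>
      using s(1)[of n] by (simp add: field_simps)
    have f_int: "integrable lebesgue_Rplus (?f n)"
      unfolding eq using int exp_int by (intro integrable_mult_right Bochner_Integration.integrable_diff)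
    have f_nonneg: "0 \<le> ?f n \<tau>" if "\<tau> \<in> space lebesgue_Rplus" for \<tau>
      using that s(1)[of n] nonneg[of \<tau>] by (auto simp: space_restrict_space)
    have "(\<integral>\<tau>. ?f n \<tau> \<partial>lebesgue_Rplus) = 1 / s n * (1 - mittag_leffler \<beta> (- s n))"
      unfolding eq using int exp_int laplace[of "s n"] s(1)[of n] M_density_prob_space(2)[OF M] by simp
    also have "\<dots> \<le> C"
      using C(2)[of "s n"] s[of n] by (simp add: field_simps)
    finally have le_C: "(\<integral>\<tau>. ?f n \<tau> \<partial>lebesgue_Rplus) \<le> C" .
    have "(\<integral>\<^sup>+\<tau>. ennreal (?f n \<tau>) \<partial>lebesgue_Rplus) = ennreal (\<integral>\<tau>. ?f n \<tau> \<partial>lebesgue_Rplus)"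
      by (rule nn_integral_eq_integral[OF f_int AE_I2[OF f_nonneg]])
    then show ?thesis
      using le_C by (simp add: ennreal_leI)
  qed
  have "(\<integral>\<^sup>+\<tau>. ennreal \<tau> \<partial>law_of_density M) = (\<integral>\<^sup>+\<tau>. ennreal (\<tau> * M \<tau>) \<partial>lebesgue_Rplus)"
  proof -
    have "(\<integral>\<^sup>+\<tau>. ennreal \<tau> \<partial>law_of_density M) = (\<integral>\<^sup>+\<tau>. ennreal (M \<tau>) * ennreal \<tau> \<partial>lebesgue_Rplus)"
      unfolding law_of_density_def by (rule nn_integral_density) simp_all
    also have "\<dots> = (\<integral>\<^sup>+\<tau>. ennreal (\<tau> * M \<tau>) \<partial>lebesgue_Rplus)"
      using nonneg by (intro nn_integral_cong) (simp add: space_restrict_space ennreal_mult mult.commute)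
    finally show ?thesis .
  qed
  also have "\<dots> = (\<integral>\<^sup>+\<tau>. liminf (\<lambda>n. ennreal (?f n \<tau>)) \<partial>lebesgue_Rplus)"
    by (intro nn_integral_cong lim_imp_Liminf[symmetric] tendsto_ennrealI f_lim) simp
  also have "\<dots> \<le> liminf (\<lambda>n. \<integral>\<^sup>+\<tau>. ennreal (?f n \<tau>) \<partial>lebesgue_Rplus)"
    by (rule nn_integral_liminf) simp
  also have "\<dots> \<le> ennreal C"
    using f_int by (intro Liminf_le) auto
  also have "\<dots> < \<infinity>"
    by simp
  finally show ?thesis .
qed

section \<open>Cameron-Martin paths and joint measurability\<close>

text \<open>
  The inequality \<open>\<bar>x\<bar> \<le> 1 + x\<^sup>2\<close> shows that a square integrable function is integrable on \<open>[0, t]\<close>, with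
  integral at most \<open>t + C\<close>. Linear growth is what the finite mean of the random time can compensate.
\<close>

lemma L2_derivative_bounds:
  assumes "has_L2_derivative h h'"
  shows "h \<in> paths" and "\<exists>C. \<forall>t\<ge>0. \<bar>h t\<bar> \<le> t + C"
proof -
  have h: "h t = (LBINT r:{0..t}. h' r)" for t
    using assms by (simp add: has_L2_derivative_def)
  have meas: "h' \<in> borel_measurable lebesgue_Rplus" and int2: "integrable lebesgue_Rplus (\<lambda>r. (h' r)\<^sup>2)"
    using assms by (auto simp: has_L2_derivative_def L2_Rplus_def)
  define k where "k r = indicator {0..} r * h' r" for r
  have [measurable]: "k \<in> borel_measurable lborel"
    using meas by (simp add: borel_measurable_restrict_space_iff k_def[abs_def])
  have "(\<lambda>r. (k r)\<^sup>2) = (\<lambda>r. indicator {0..} r *\<^sub>R (h' r)\<^sup>2)"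
    by (auto simp: k_def indicator_def fun_eq_iff)
  then have k2: "integrable lborel (\<lambda>r. (k r)\<^sup>2)"
    using int2 by (simp add: integrable_restrict_space)
  have bound: "\<bar>indicator {0..t} r * k r\<bar> \<le> indicator {0..t} r + (k r)\<^sup>2" for t r
  proof -
    have "\<bar>k r\<bar> \<le> 1 + (k r)\<^sup>2"
      using sum_squares_ge_zero[of "\<bar>k r\<bar> - 1" 0] by (simp add: power2_eq_square algebra_simps)
    then show ?thesis
      by (auto simp: indicator_def)
  qed
  have ind: "integrable lborel (indicator {0..t} :: real \<Rightarrow> real)" for t
    by (cases "0 \<le> t") auto
  have k_int: "set_integrable lborel {0..t} k" for t
    unfolding set_integrable_def
    by (rule Bochner_Integration.integrable_bound[OF Bochner_Integration.integrable_add[OF ind k2]])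
       (use bound in \<open>auto intro!: AE_I2 order_trans[OF _ abs_ge_self]\<close>)
  have h_k: "h t = (LBINT r:{0..t}. k r)" for t
    unfolding h by (intro set_lebesgue_integral_cong) (auto simp: k_def)
  have h_cont: "continuous_on {0..b} h" for b
  proof -
    have "continuous_on {0..b} (\<lambda>x. Henstock_Kurzweil_Integration.integral {0..x} k)"
      by (intro indefinite_integral_continuous_1 set_borel_integral_eq_integral(1) k_int)
    moreover have "Henstock_Kurzweil_Integration.integral {0..x} k = h x" for x
      unfolding h_k by (rule set_borel_integral_eq_integral(2)[OF k_int, symmetric])
    ultimately show ?thesis by simp
  qed
  have "continuous_on {0..} h"
    unfolding continuous_on_eq_continuous_within
  proof
    fix x :: real assume "x \<in> {0..}"
    then have "continuous (at x within {0..x + 1}) h"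
      using h_cont[of "x + 1"] by (auto simp: continuous_on_eq_continuous_within)
    moreover have "at x within {0..x + 1} = at x within {0..}"
      by (rule at_within_nhd[of x "{..<x + 1}"]) auto
    ultimately show "continuous (at x within {0..}) h"
      by simp
  qed
  moreover have "h 0 = 0"
    unfolding h_k by (simp add: set_lebesgue_integral_def) (rule integral_eq_zero_AE, rule AE_I[of _ _ "{0}"], auto simp: indicator_def)
  moreover have "h t = 0" if "t < 0" for t
    unfolding h using that by (simp add: set_lebesgue_integral_def)
  ultimately show "h \<in> paths"
    by (simp add: paths_def)
  have "\<bar>h t\<bar> \<le> t + (\<integral>r. (k r)\<^sup>2 \<partial>lborel)" if "0 \<le> t" for t
  proof -
    have "\<bar>h t\<bar> \<le> (\<integral>r. indicator {0..t} r + (k r)\<^sup>2 \<partial>lborel)"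
      unfolding h_k set_lebesgue_integral_def
      using k_int[of t] bound ind k2
      by (intro integral_abs_bound_integral) (auto simp: set_integrable_def)
    also have "\<dots> = t + (\<integral>r. (k r)\<^sup>2 \<partial>lborel)"
      using ind[of t] k2 that by simp
    finally show ?thesis .
  qed
  then show "\<exists>C. \<forall>t\<ge>0. \<bar>h t\<bar> \<le> t + C"
    by blast
qed

text \<open>
  Joint measurability of a process that is continuous in time: evaluate at the time \<open>\<theta> x\<close> rounded
  down to a multiple of \<open>1 / (k + 1)\<close>, which takes countably many values, and let \<open>k \<rightarrow> \<infinity>\<close>.
\<close>

lemma borel_measurable_caratheodory:
  fixes X :: "real \<Rightarrow> 'a \<Rightarrow> real"
  assumes X: "\<And>t. 0 \<le> t \<Longrightarrow> X t \<in> borel_measurable N"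
    and cont: "\<And>w. w \<in> space N \<Longrightarrow> continuous_on {0..} (\<lambda>t. X t w)"
    and \<theta>[measurable]: "\<theta> \<in> borel_measurable L" and \<theta>_nonneg: "\<And>x. x \<in> space L \<Longrightarrow> 0 \<le> \<theta> x"
  shows "(\<lambda>(w, x). X (\<theta> x) w) \<in> borel_measurable (N \<Otimes>\<^sub>M L)"
proof -
  define a where "a k y = real (nat \<lfloor>real (Suc k) * y\<rfloor>) / real (Suc k)" for k y
  have a_lim: "(\<lambda>k. a k y) \<longlonglongrightarrow> y" if "0 \<le> y" for y
  proof (rule tendsto_sandwich)
    have bounds: "y - inverse (real (Suc k)) \<le> a k y \<and> a k y \<le> y" for k
    proof -
      define N where "N = real (Suc k)"
      have N: "0 < N" by (simp add: N_def)
      then have "real (nat \<lfloor>N * y\<rfloor>) = of_int \<lfloor>N * y\<rfloor>"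
        using that by (simp add: of_nat_nat)
      moreover have "of_int \<lfloor>N * y\<rfloor> \<le> N * y" "N * y - 1 \<le> of_int \<lfloor>N * y\<rfloor>"
        by linarith+
      ultimately show ?thesis
        unfolding a_def N_def[symmetric] using N
        by (simp add: pos_le_divide_eq pos_divide_le_eq left_diff_distrib right_diff_distrib mult.commute)
    qed
    show "\<forall>\<^sub>F k in sequentially. y - inverse (real (Suc k)) \<le> a k y"
      "\<forall>\<^sub>F k in sequentially. a k y \<le> y"
      using bounds by auto
    show "(\<lambda>k. y - inverse (real (Suc k))) \<longlonglongrightarrow> y"
      using tendsto_diff[OF tendsto_const LIMSEQ_inverse_real_of_nat, of y] by simp
  qed simp
  show ?thesis
  proof (rule borel_measurable_LIMSEQ_real)
    fix k
    have "(\<lambda>x. (\<lambda>i x. X (real i / real (Suc k)) (fst x)) (nat \<lfloor>real (Suc k) * \<theta> (snd x)\<rfloor>) x) \<in> borel_measurable (N \<Otimes>\<^sub>M L)"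
      by (rule measurable_compose_countable)
         (auto intro!: measurable_compose[OF measurable_fst X])
    then show "(\<lambda>x. X (a k (\<theta> (snd x))) (fst x)) \<in> borel_measurable (N \<Otimes>\<^sub>M L)"
      by (simp add: a_def)
  next
    fix x assume "x \<in> space (N \<Otimes>\<^sub>M L)"
    then have "fst x \<in> space N" "0 \<le> \<theta> (snd x)"
      using \<theta>_nonneg by (auto simp: space_pair_measure)
    then show "(\<lambda>k. X (a k (\<theta> (snd x))) (fst x)) \<longlonglongrightarrow> (case x of (w, x) \<Rightarrow> X (\<theta> x) w)"
      unfolding split_def
      by (intro continuous_on_tendsto_compose[OF cont a_lim]) (auto simp: a_def)
  qed
qed

section \<open>Integration by parts with random time\<close>

lemma paths_add_scale:
  assumes "w \<in> paths" "h \<in> paths"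
  shows "(\<lambda>s. w s + \<epsilon> * h s) \<in> paths"
  using assms by (auto simp: paths_def intro!: continuous_intros)

lemma FCb_infinity_cylinder:
  assumes "F \<in> FCb_infinity T" "0 \<le> \<tau>"
  obtains U \<Phi> \<gamma> where "C1_cylinder U \<Phi> \<gamma>" "U \<subseteq> {0..T * \<tau>}" "\<And>w. w \<in> paths \<Longrightarrow> F (w, \<tau>) = \<Phi> w"
proof -
  obtain n t f where F: "\<And>i. i < n \<Longrightarrow> 0 < t i \<and> t i \<le> T" "f \<in> Cb_infinity n"
    "\<And>w. w \<in> paths \<Longrightarrow> F (w, \<tau>) = f (\<lambda>i. if i < n then w (t i * \<tau>) else 0)"
    using assms unfolding FCb_infinity_def by blast
  have t: "0 \<le> t i * \<tau>" "t i * \<tau> \<le> T * \<tau>" if "i < n" for i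
    using F(1)[OF that] assms(2) by (auto intro: mult_right_mono)
  show ?thesis
    by (rule that[OF C1_cylinder_Cb_infinity[OF F(2), of "\<lambda>i. t i * \<tau>"]]) (use t F(3) in auto)
qed

lemma partial1_eqI:
  assumes "((\<lambda>\<epsilon>. F (\<lambda>s. w s + \<epsilon> * h s, \<tau>)) has_real_derivative D) (at 0)"
  shows "partial1 h F (w, \<tau>) = D"
  using assms by (auto simp: partial1_def DERIV_def intro!: tendsto_Lim)

lemma has_derivative_partial1:
  assumes F: "F \<in> FCb_infinity T" and h: "h \<in> paths" and "w \<in> paths" "0 \<le> \<tau>"
  shows "((\<lambda>\<epsilon>. F (\<lambda>s. w s + \<epsilon> * h s, \<tau>)) has_real_derivative partial1 h F (w, \<tau>)) (at 0)"
proof -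
  obtain U \<Phi> \<gamma> where cyl: "C1_cylinder U \<Phi> \<gamma>" and eq: "\<And>w. w \<in> paths \<Longrightarrow> F (w, \<tau>) = \<Phi> w"
    using FCb_infinity_cylinder[OF F \<open>0 \<le> \<tau>\<close>] by metis
  have deriv: "((\<lambda>\<epsilon>. F (\<lambda>s. w s + \<epsilon> * h s, \<tau>)) has_real_derivative (\<Sum>u\<in>U. \<gamma> u w * h u)) (at 0)"
    using C1_cylinder_deriv_0[OF cyl, of w h] by (simp add: eq paths_add_scale[OF \<open>w \<in> paths\<close> h])
  show ?thesis
    unfolding partial1_eqI[OF deriv] by (rule deriv)
qed

lemma FCb_infinity_regular:
  assumes F: "F \<in> FCb_infinity T" and h: "h \<in> paths" and bound_h: "\<forall>t\<ge>0. \<bar>h t\<bar> \<le> t + A"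
    and P: "wiener_measure P"
  shows "F \<in> borel_measurable (P \<Otimes>\<^sub>M law_of_density M)"
    and "partial1 h F \<in> borel_measurable (P \<Otimes>\<^sub>M law_of_density M)"
    and "\<exists>C\<ge>0. \<forall>w\<in>paths. \<forall>\<tau>\<ge>0. \<bar>F (w, \<tau>)\<bar> \<le> C"
    and "\<exists>C\<ge>0. \<forall>w\<in>paths. \<forall>\<tau>\<ge>0. \<bar>partial1 h F (w, \<tau>)\<bar> \<le> C * (1 + \<tau>)"
proof -
  let ?PL = "P \<Otimes>\<^sub>M law_of_density M"
  obtain n t f where t: "\<And>i. i < n \<Longrightarrow> 0 < t i" and f: "f \<in> Cb_infinity n"
    and Ff: "\<And>w \<tau>. w \<in> paths \<Longrightarrow> 0 \<le> \<tau> \<Longrightarrow> F (w, \<tau>) = f (\<lambda>i. if i < n then w (t i * \<tau>) else 0)"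
    using F unfolding FCb_infinity_def by blast
  have space: "space ?PL = paths \<times> {0..}"
    by (simp add: space_pair_measure wiener_space[OF P] space_law_of_density)
  have [measurable]: "(\<lambda>\<tau>. \<tau>) \<in> borel_measurable (law_of_density M)"
    by (rule measurable_law_of_density_id)
  have coord: "(\<lambda>x. fst x (t i * snd x)) \<in> borel_measurable ?PL" if "i < n" for i
    using borel_measurable_caratheodory[of "\<lambda>t w. w t" P "\<lambda>\<tau>. t i * \<tau>" "law_of_density M"]
      wiener_measurable_coord[OF P] t[OF that]
    by (simp add: split_def wiener_space[OF P] paths_def space_law_of_density)
  have hcont: "continuous_on {0..} h"
    using h by (simp add: paths_def)
  have h_meas: "(\<lambda>x. h (t i * snd x)) \<in> borel_measurable ?PL" if "i < n" for i
    using borel_measurable_caratheodory[of "\<lambda>t w. h t" P "\<lambda>\<tau>. t i * \<tau>" "law_of_density M"]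
      t[OF that] hcont
    by (simp add: split_def space_law_of_density)
  have part: "partial1 h F (w, \<tau>) =
      (\<Sum>i<n. partial_deriv i f (\<lambda>i. if i < n then w (t i * \<tau>) else 0) * h (t i * \<tau>))"
    if "w \<in> paths" "0 \<le> \<tau>" for w \<tau>
    using Cb_infinity_chain_rule[OF f, of "\<lambda>i. w (t i * \<tau>)" "\<lambda>i. h (t i * \<tau>)"] that
    by (intro partial1_eqI) (simp add: Ff paths_add_scale h)
  note pd = Cb_infinity_partial_deriv[OF f]
  have "(\<lambda>x. f (\<lambda>i. if i < n then fst x (t i * snd x) else 0)) \<in> borel_measurable ?PL"
    by (intro borel_measurable_Cb_infinity[OF f] coord)
  then show "F \<in> borel_measurable ?PL"
    by (rule measurable_cong[THEN iffD2, rotated]) (auto simp: space Ff cong: if_cong)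
  have "(\<lambda>x. \<Sum>i<n. partial_deriv i f (\<lambda>i. if i < n then fst x (t i * snd x) else 0) * h (t i * snd x))
      \<in> borel_measurable ?PL"
    by (intro borel_measurable_sum borel_measurable_times borel_measurable_Cb_infinity[OF pd] coord h_meas) auto
  then show "partial1 h F \<in> borel_measurable ?PL"
    by (rule measurable_cong[THEN iffD2, rotated]) (auto simp: space part cong: if_cong)
  have bdd: "\<exists>C\<ge>0. \<forall>x. \<bar>g (\<lambda>i. if i < n then x i else 0)\<bar> \<le> C" if g: "g \<in> Cb_infinity n" for g
  proof -
    obtain C where "\<And>x. x \<in> Rn n \<Longrightarrow> \<bar>g x\<bar> \<le> C"
      using Cb_infinity_bounded[OF g] by (auto simp: bounded_iff)
    then show ?thesis
      by (intro exI[of _ "max 0 C"]) (auto simp: Rn_def le_max_iff_disj)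
  qed
  show "\<exists>C\<ge>0. \<forall>w\<in>paths. \<forall>\<tau>\<ge>0. \<bar>F (w, \<tau>)\<bar> \<le> C"
    using bdd[OF f] by (metis Ff)
  have "\<forall>i. \<exists>C\<ge>0. i < n \<longrightarrow> (\<forall>x. \<bar>partial_deriv i f (\<lambda>i. if i < n then x i else 0)\<bar> \<le> C)"
    using bdd[OF pd] by blast
  then obtain C where C: "\<And>i. 0 \<le> C i"
    "\<And>i x. i < n \<Longrightarrow> \<bar>partial_deriv i f (\<lambda>i. if i < n then x i else 0)\<bar> \<le> C i"
    by metis
  have A: "0 \<le> A"
    using bound_h[rule_format, of 0] by simp
  show "\<exists>C\<ge>0. \<forall>w\<in>paths. \<forall>\<tau>\<ge>0. \<bar>partial1 h F (w, \<tau>)\<bar> \<le> C * (1 + \<tau>)"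
  proof (intro exI[of _ "\<Sum>i<n. C i * (t i + A)"] conjI ballI allI impI)
    show "0 \<le> (\<Sum>i<n. C i * (t i + A))"
      using C(1) A t by (intro sum_nonneg mult_nonneg_nonneg add_nonneg_nonneg) (auto intro: less_imp_le)
    fix w :: "real \<Rightarrow> real" and \<tau> :: real assume w: "w \<in> paths" "0 \<le> \<tau>"
    have "\<bar>partial1 h F (w, \<tau>)\<bar> \<le> (\<Sum>i<n. C i * ((t i + A) * (1 + \<tau>)))"
      unfolding part[OF w]
    proof (rule order_trans[OF sum_abs], intro sum_mono, unfold abs_mult, intro mult_mono)
      fix i assume "i \<in> {..<n}"
      then have i: "0 < t i" "\<bar>h (t i * \<tau>)\<bar> \<le> t i * \<tau> + A"
        using t[of i] bound_h w by auto
      have "(t i + A) * (1 + \<tau>) = (t i * \<tau> + A) + t i + A * \<tau>"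
        by (simp add: algebra_simps)
      then show "\<bar>h (t i * \<tau>)\<bar> \<le> (t i + A) * (1 + \<tau>)"
        using i mult_nonneg_nonneg[OF A w(2)] by linarith
    qed (use C in auto)
    then show "\<bar>partial1 h F (w, \<tau>)\<bar> \<le> (\<Sum>i<n. C i * (t i + A)) * (1 + \<tau>)"
      by (simp add: sum_distrib_right mult.assoc)
  qed
qed

text \<open>
  Integration by parts against the Wiener integral, applied to the cylinder functional \<open>F G\<close>. Its
  directional derivative along \<open>h\<close> is computed once through the gradient and once by the Leibniz
  rule; the two agree as derivatives of the same function. The cut-off of \<open>h'\<close> at \<open>T \<tau>\<close> does not
  affect \<open>h u\<close>, because all times are at most \<open>T \<tau>\<close>.
\<close>

lemma integration_by_parts_fixed_time:
  assumes P: "wiener_measure P" and h: "has_L2_derivative h h'"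
    and I: "is_wiener_integral P (\<lambda>r. indicator {0..T * \<tau>} r * h' r) X"
    and F: "F \<in> FCb_infinity T" and G: "G \<in> FCb_infinity T" and \<tau>: "0 \<le> \<tau>"
  shows "(\<integral>w. G (w, \<tau>) * partial1 h F (w, \<tau>) + F (w, \<tau>) * partial1 h G (w, \<tau>)
             - F (w, \<tau>) * G (w, \<tau>) * X w \<partial>P) = 0"
proof -
  obtain U \<Phi> \<gamma> where F': "C1_cylinder U \<Phi> \<gamma>" "U \<subseteq> {0..T * \<tau>}" "\<And>w. w \<in> paths \<Longrightarrow> F (w, \<tau>) = \<Phi> w"
    using FCb_infinity_cylinder[OF F \<tau>] by metis
  obtain V \<Psi> \<delta> where G': "C1_cylinder V \<Psi> \<delta>" "V \<subseteq> {0..T * \<tau>}" "\<And>w. w \<in> paths \<Longrightarrow> G (w, \<tau>) = \<Psi> w"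
    using FCb_infinity_cylinder[OF G \<tau>] by metis
  define \<eta> where "\<eta> u w = (if u \<in> U then \<gamma> u w * \<Psi> w else 0) + (if u \<in> V then \<Phi> w * \<delta> u w else 0)" for u w
  have FG: "C1_cylinder (U \<union> V) (\<lambda>w. \<Phi> w * \<Psi> w) \<eta>"
    using C1_cylinder_mult[OF F'(1) G'(1)] by (simp add: \<eta>_def[abs_def])
  have h_paths: "h \<in> paths"
    by (rule L2_derivative_bounds(1)[OF h])
  have eq: "G (w, \<tau>) * partial1 h F (w, \<tau>) + F (w, \<tau>) * partial1 h G (w, \<tau>) = (\<Sum>u\<in>U \<union> V. \<eta> u w * h u)"
    if w: "w \<in> paths" for w
  proof -
    have "((\<lambda>\<epsilon>. F (\<lambda>s. w s + \<epsilon> * h s, \<tau>) * G (\<lambda>s. w s + \<epsilon> * h s, \<tau>)) has_real_derivative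
        G (w, \<tau>) * partial1 h F (w, \<tau>) + F (w, \<tau>) * partial1 h G (w, \<tau>)) (at 0)"
      using DERIV_mult[OF has_derivative_partial1[OF F h_paths w \<tau>] has_derivative_partial1[OF G h_paths w \<tau>]]
      by (simp add: ac_simps)
    moreover have "((\<lambda>\<epsilon>. F (\<lambda>s. w s + \<epsilon> * h s, \<tau>) * G (\<lambda>s. w s + \<epsilon> * h s, \<tau>)) has_real_derivative
        (\<Sum>u\<in>U \<union> V. \<eta> u w * h u)) (at 0)"
      using C1_cylinder_deriv_0[OF FG, of w h] by (simp add: F' G' paths_add_scale[OF w h_paths])
    ultimately show ?thesis
      by (rule DERIV_unique)
  qed
  have h'_meas: "h' \<in> borel_measurable lebesgue_Rplus"
    using h by (simp add: has_L2_derivative_def L2_Rplus_def)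
  have meas: "(\<lambda>r. indicator {0..T * \<tau>} r * h' r) \<in> borel_measurable lebesgue_Rplus"
    by (intro borel_measurable_times h'_meas measurable_restrict_space1) simp
  note ibp = wiener_integral_integration_by_parts[OF P FG I meas]
  have "(\<integral>w. G (w, \<tau>) * partial1 h F (w, \<tau>) + F (w, \<tau>) * partial1 h G (w, \<tau>)
             - F (w, \<tau>) * G (w, \<tau>) * X w \<partial>P) =
        (\<integral>w. (\<Sum>u\<in>U \<union> V. \<eta> u w * h u) - \<Phi> w * \<Psi> w * X w \<partial>P)"
    by (intro Bochner_Integration.integral_cong) (auto simp: wiener_space[OF P] eq[symmetric] F'(3) G'(3))
  also have "\<dots> = (\<Sum>u\<in>U \<union> V. (\<integral>w. \<eta> u w \<partial>P) * h u) - (\<integral>w. \<Phi> w * \<Psi> w * X w \<partial>P)"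
    using C1_cylinder_wiener(4)[OF P FG] integrable_C1_cylinder_mult[OF P FG ibp(1)] by simp
  also have "(\<Sum>u\<in>U \<union> V. (\<integral>w. \<eta> u w \<partial>P) * h u) = (\<integral>w. \<Phi> w * \<Psi> w * X w \<partial>P)"
    unfolding ibp(2)
  proof (intro sum.cong refl arg_cong2[where f="(*)"])
    fix u assume "u \<in> U \<union> V"
    then have "u \<le> T * \<tau>" using F'(2) G'(2) by auto
    then have "(LBINT r:{0..u}. indicator {0..T * \<tau>} r * h' r) = (LBINT r:{0..u}. h' r)"
      by (intro set_lebesgue_integral_cong) (auto simp: indicator_def)
    then show "h u = (LBINT r:{0..u}. indicator {0..T * \<tau>} r * h' r)"
      using h by (simp add: has_L2_derivative_def)
  qed
  finally show ?thesis by simp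
qed

theorem theorem4p3:
  fixes \<beta> T :: real
    and P :: "(real \<Rightarrow> real) measure"
    and M h h' :: "real \<Rightarrow> real"
    and I :: "real \<Rightarrow> (real \<Rightarrow> real) \<Rightarrow> real"
    and F G :: "(real \<Rightarrow> real) \<times> real \<Rightarrow> real"
  assumes "0 < \<beta>" and "\<beta> < 1" and "0 < T"
    and "wiener_measure P"
    and "is_M_density \<beta> M"
    and "h \<in> cameron_martin" and "has_L2_derivative h h'"
    and "is_continuous_wiener_integral_process P h' I"
    and "F \<in> FCb_infinity T" and "G \<in> FCb_infinity T"
  shows "integrable (P \<Otimes>\<^sub>M law_of_density M) (\<lambda>x. G x * partial1 h F x) \<and>
         integrable (P \<Otimes>\<^sub>M law_of_density M) (\<lambda>x. F x * partial1_adjoint T h I G x) \<and>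
         (\<integral>x. G x * partial1 h F x \<partial>(P \<Otimes>\<^sub>M law_of_density M)) =
         (\<integral>x. F x * partial1_adjoint T h I G x \<partial>(P \<Otimes>\<^sub>M law_of_density M))"
proof -
  note P = \<open>wiener_measure P\<close> and h = \<open>has_L2_derivative h h'\<close>
    and F = \<open>F \<in> FCb_infinity T\<close> and G = \<open>G \<in> FCb_infinity T\<close>
  let ?L = "law_of_density M"
  let ?PL = "P \<Otimes>\<^sub>M ?L"
  have I_int: "is_wiener_integral P (\<lambda>r. indicator {0..t} r * h' r) (I t)" if "0 \<le> t" for t
    using assms(8) that by (auto simp: is_continuous_wiener_integral_process_def)
  have I_cont: "continuous_on {0..} (\<lambda>t. I t w)" if "w \<in> paths" for w
    using assms(8) that by (auto simp: is_continuous_wiener_integral_process_def)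
  interpret P: prob_space P by (rule wiener_prob_space[OF P])
  interpret L: prob_space ?L by (rule M_density_prob_space(3)[OF assms(5)])
  interpret PL: pair_sigma_finite P ?L ..
  note space_P = wiener_space[OF P]
  note space_L = space_law_of_density[of M]
  have [measurable]: "(\<lambda>\<tau>. \<tau>) \<in> borel_measurable ?L"
    by (rule measurable_law_of_density_id)
  obtain A where h_paths: "h \<in> paths" and A: "\<forall>t\<ge>0. \<bar>h t\<bar> \<le> t + A"
    using L2_derivative_bounds[OF h] by blast
  note reg_F = FCb_infinity_regular[OF F h_paths A P]
    and reg_G = FCb_infinity_regular[OF G h_paths A P]
  note [measurable] = reg_F(1,2)[of M] reg_G(1,2)[of M]
  have I_meas[measurable]: "(\<lambda>x. I (T * snd x) (fst x)) \<in> borel_measurable ?PL"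
    using borel_measurable_caratheodory[of I P "\<lambda>\<tau>. T * \<tau>" ?L] I_int I_cont \<open>0 < T\<close>
    by (simp add: is_wiener_integral_def split_def space_P space_L)
  obtain CF where CF: "0 \<le> CF" "\<And>w \<tau>. w \<in> paths \<Longrightarrow> 0 \<le> \<tau> \<Longrightarrow> \<bar>F (w, \<tau>)\<bar> \<le> CF"
    using reg_F(3) by blast
  obtain CG where CG: "0 \<le> CG" "\<And>w \<tau>. w \<in> paths \<Longrightarrow> 0 \<le> \<tau> \<Longrightarrow> \<bar>G (w, \<tau>)\<bar> \<le> CG"
    using reg_G(3) by blast
  obtain DF where DF: "0 \<le> DF" "\<And>w \<tau>. w \<in> paths \<Longrightarrow> 0 \<le> \<tau> \<Longrightarrow> \<bar>partial1 h F (w, \<tau>)\<bar> \<le> DF * (1 + \<tau>)"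
    using reg_F(4) by blast
  obtain DG where DG: "0 \<le> DG" "\<And>w \<tau>. w \<in> paths \<Longrightarrow> 0 \<le> \<tau> \<Longrightarrow> \<bar>partial1 h G (w, \<tau>)\<bar> \<le> DG * (1 + \<tau>)"
    using reg_G(4) by blast
  (* A growth of order 1 + \<tau> in the random time is integrable because of its finite mean. *)
  have integrableI: "integrable ?PL f"
    if [measurable]: "f \<in> borel_measurable ?PL" and "0 \<le> C"
      and bound: "\<And>\<tau>. 0 \<le> \<tau> \<Longrightarrow> (\<integral>\<^sup>+w. ennreal \<bar>f (w, \<tau>)\<bar> \<partial>P) \<le> ennreal (C * (1 + \<tau>))"
    for f :: "(real \<Rightarrow> real) \<times> real \<Rightarrow> real" and C
  proof (rule integrableI_bounded)
    have "(\<integral>\<^sup>+x. ennreal (norm (f x)) \<partial>?PL) = (\<integral>\<^sup>+\<tau>. (\<integral>\<^sup>+w. ennreal \<bar>f (w, \<tau>)\<bar> \<partial>P) \<partial>?L)"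
      by (subst PL.nn_integral_snd[symmetric]) auto
    also have "\<dots> \<le> (\<integral>\<^sup>+\<tau>. ennreal C * (1 + ennreal \<tau>) \<partial>?L)"
    proof (rule nn_integral_mono)
      fix \<tau> assume "\<tau> \<in> space ?L"
      then have "0 \<le> \<tau>" by (simp add: space_L)
      with \<open>0 \<le> C\<close> have "ennreal (C * (1 + \<tau>)) = ennreal C * (1 + ennreal \<tau>)"
        by (simp add: ennreal_mult ennreal_plus[symmetric] ennreal_1[symmetric] del: ennreal_plus ennreal_1)
      then show "(\<integral>\<^sup>+w. ennreal \<bar>f (w, \<tau>)\<bar> \<partial>P) \<le> ennreal C * (1 + ennreal \<tau>)"
        using bound[OF \<open>0 \<le> \<tau>\<close>] by simp
    qed
    also have "\<dots> = ennreal C * (1 + (\<integral>\<^sup>+\<tau>. ennreal \<tau> \<partial>?L))"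
      by (simp add: nn_integral_cmult nn_integral_add L.emeasure_space_1)
    also have "\<dots> < \<infinity>"
      using M_density_first_moment[OF assms(1,5)] by (simp add: ennreal_mult_less_top less_top)
    finally show "(\<integral>\<^sup>+x. ennreal (norm (f x)) \<partial>?PL) < \<infinity>" .
  qed simp
  have bounded_integrable: "integrable ?PL f"
    if f: "f \<in> borel_measurable ?PL" and "0 \<le> C"
      and bound: "\<And>w \<tau>. w \<in> paths \<Longrightarrow> 0 \<le> \<tau> \<Longrightarrow> \<bar>f (w, \<tau>)\<bar> \<le> C * (1 + \<tau>)"
    for f :: "(real \<Rightarrow> real) \<times> real \<Rightarrow> real" and C
  proof (rule integrableI[OF f \<open>0 \<le> C\<close>])
    fix \<tau> :: real assume "0 \<le> \<tau>"
    then have "(\<integral>\<^sup>+w. ennreal \<bar>f (w, \<tau>)\<bar> \<partial>P) \<le> (\<integral>\<^sup>+w. ennreal (C * (1 + \<tau>)) \<partial>P)"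
      by (intro nn_integral_mono ennreal_leI bound) (auto simp: space_P)
    then show "(\<integral>\<^sup>+w. ennreal \<bar>f (w, \<tau>)\<bar> \<partial>P) \<le> ennreal (C * (1 + \<tau>))"
      by (simp add: P.emeasure_space_1)
  qed
  have int1: "integrable ?PL (\<lambda>x. G x * partial1 h F x)"
    by (rule bounded_integrable[of _ "CG * DF"])
       (use CG DF in \<open>auto simp: abs_mult mult.assoc intro!: mult_mono\<close>)
  have int2: "integrable ?PL (\<lambda>x. F x * partial1 h G x)"
    by (rule bounded_integrable[of _ "CF * DG"])
       (use CF DG in \<open>auto simp: abs_mult mult.assoc intro!: mult_mono\<close>)
  define B where "B = (\<integral>r. (h' r)\<^sup>2 \<partial>lebesgue_Rplus)"
  have h'_meas: "h' \<in> borel_measurable lebesgue_Rplus" and h'_int: "integrable lebesgue_Rplus (\<lambda>r. (h' r)\<^sup>2)"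
    using h by (auto simp: has_L2_derivative_def L2_Rplus_def)
  have B: "0 \<le> B"
    by (simp add: B_def)
  have I_L1: "(\<integral>\<^sup>+w. ennreal \<bar>I t w\<bar> \<partial>P) \<le> ennreal (1 + 4 * B)" if t: "0 \<le> t" for t
  proof -
    note It = I_int[OF t]
    have [measurable]: "I t \<in> borel_measurable P"
      using It by (simp add: is_wiener_integral_def)
    have "\<bar>x\<bar> \<le> 1 + x\<^sup>2" for x :: real
      using sum_squares_ge_zero[of "\<bar>x\<bar> - 1" 0] by (simp add: power2_eq_square algebra_simps)
    then have "(\<integral>\<^sup>+w. ennreal \<bar>I t w\<bar> \<partial>P) \<le> (\<integral>\<^sup>+w. 1 + ennreal ((I t w)\<^sup>2) \<partial>P)"
      by (intro nn_integral_mono) (simp add: ennreal_plus[symmetric] ennreal_1[symmetric] ennreal_leI del: ennreal_plus ennreal_1)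
    also have "\<dots> = 1 + (\<integral>\<^sup>+w. ennreal ((I t w)\<^sup>2) \<partial>P)"
      by (simp add: nn_integral_add P.emeasure_space_1)
    also have "(\<integral>\<^sup>+w. ennreal ((I t w)\<^sup>2) \<partial>P) \<le> 4 * (\<integral>\<^sup>+r. ennreal ((indicator {0..t} r * h' r)\<^sup>2) \<partial>lebesgue_Rplus)"
      by (rule wiener_integral_L2_bound[OF P It])
         (intro borel_measurable_times h'_meas measurable_restrict_space1, simp)
    also have "(\<integral>\<^sup>+r. ennreal ((indicator {0..t} r * h' r)\<^sup>2) \<partial>lebesgue_Rplus) \<le> (\<integral>\<^sup>+r. ennreal ((h' r)\<^sup>2) \<partial>lebesgue_Rplus)"
      by (intro nn_integral_mono ennreal_leI) (auto simp: indicator_def)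
    also have "\<dots> = ennreal B"
      unfolding B_def by (intro nn_integral_eq_integral h'_int) auto
    also have "1 + 4 * ennreal B = ennreal (1 + 4 * B)"
      using B by (simp add: ennreal_mult)
    finally show ?thesis
      by (simp add: add_left_mono mult_left_mono)
  qed
  have int3: "integrable ?PL (\<lambda>x. F x * G x * I (T * snd x) (fst x))"
  proof (rule integrableI)
    show "0 \<le> CF * CG * (1 + 4 * B)"
      using CF(1) CG(1) B by simp
    fix \<tau> :: real assume \<tau>: "0 \<le> \<tau>"
    have T\<tau>: "0 \<le> T * \<tau>" using \<tau> \<open>0 < T\<close> by simp
    have [measurable]: "I (T * \<tau>) \<in> borel_measurable P"
      using I_int[OF T\<tau>] by (simp add: is_wiener_integral_def)
    have "\<bar>F (w, \<tau>) * G (w, \<tau>) * I (T * \<tau>) w\<bar> \<le> CF * CG * \<bar>I (T * \<tau>) w\<bar>" if "w \<in> paths" for w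
      unfolding abs_mult using CF CG that \<tau> by (intro mult_mono) auto
    then have "(\<integral>\<^sup>+w. ennreal \<bar>F (w, \<tau>) * G (w, \<tau>) * I (T * \<tau>) w\<bar> \<partial>P) \<le>
        (\<integral>\<^sup>+w. ennreal (CF * CG) * ennreal \<bar>I (T * \<tau>) w\<bar> \<partial>P)"
      using CF(1) CG(1) by (intro nn_integral_mono) (simp add: ennreal_mult[symmetric] ennreal_leI space_P)
    also have "\<dots> = ennreal (CF * CG) * (\<integral>\<^sup>+w. ennreal \<bar>I (T * \<tau>) w\<bar> \<partial>P)"
      by (simp add: nn_integral_cmult)
    also have "\<dots> \<le> ennreal (CF * CG) * ennreal (1 + 4 * B)"
      by (intro mult_left_mono I_L1 T\<tau>) simp
    also have "\<dots> = ennreal (CF * CG * (1 + 4 * B))"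
      using CF(1) CG(1) B by (intro ennreal_mult[symmetric]) auto
    also have "\<dots> \<le> ennreal (CF * CG * (1 + 4 * B) * (1 + \<tau>))"
      using CF(1) CG(1) B \<tau> mult_left_mono[of 1 "1 + \<tau>" "CF * CG * (1 + 4 * B)"]
      by (intro ennreal_leI) simp
    finally show "(\<integral>\<^sup>+w. ennreal \<bar>F (w, \<tau>) * G (w, \<tau>) * I (T * snd (w, \<tau>)) (fst (w, \<tau>))\<bar> \<partial>P) \<le>
        ennreal (CF * CG * (1 + 4 * B) * (1 + \<tau>))"
      by simp
  qed simp
  have adj: "F x * partial1_adjoint T h I G x = F x * G x * I (T * snd x) (fst x) - F x * partial1 h G x" for x
    by (cases x) (simp add: partial1_adjoint_def algebra_simps)
  have int4: "integrable ?PL (\<lambda>x. F x * partial1_adjoint T h I G x)"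
    unfolding adj using int2 int3 by simp
  have "(\<integral>x. G x * partial1 h F x \<partial>?PL) - (\<integral>x. F x * partial1_adjoint T h I G x \<partial>?PL) =
      (\<integral>x. G x * partial1 h F x - F x * partial1_adjoint T h I G x \<partial>?PL)"
    using int1 int4 by simp
  also have "\<dots> = (\<integral>\<tau>. (\<integral>w. G (w, \<tau>) * partial1 h F (w, \<tau>) - F (w, \<tau>) * partial1_adjoint T h I G (w, \<tau>) \<partial>P) \<partial>?L)"
    using int1 int4 by (subst PL.integral_snd) (auto simp: split_def)
  also have "\<dots> = (\<integral>\<tau>. 0 \<partial>?L)"
  proof (rule Bochner_Integration.integral_cong[OF refl])
    fix \<tau> assume "\<tau> \<in> space ?L"
    then have \<tau>: "0 \<le> \<tau>" by (simp add: space_L)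
    with \<open>0 < T\<close> have "0 \<le> T * \<tau>" by simp
    from integration_by_parts_fixed_time[OF P h I_int[OF this] F G \<tau>]
    show "(\<integral>w. G (w, \<tau>) * partial1 h F (w, \<tau>) - F (w, \<tau>) * partial1_adjoint T h I G (w, \<tau>) \<partial>P) = 0"
      by (simp add: adj algebra_simps)
  qed
  finally show ?thesis
    using int1 int4 by simp
qed

end
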